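(* Each of the classes $\mathcal{M}_0,\mathcal{M}_1,\mathcal{M}_2,\mathcal{M}_3$ is non-empty; that is, for each $n\in\{0,1,2,3\}$ there exists a wavelet $\psi\in L^2(\mathbb{R})$ whose core space $V_0$ is invariant under $\mathcal{G}_n$ but not under $\mathcal{G}_{n+1}$.
   Context: On $L^2(\mathbb{R})$ define the unitary operators $Df(x)=\sqrt{2}\,f(2x)$, $T_\alpha f(x)=f(x-\alpha)$ for $\alpha\in\mathbb{R}$, and $T=T_1$. A function $\psi\in L^2(\mathbb{R})$ is a wavelet if $\{D^nT^l\psi: n,l\in\mathbb{Z}\}$ is an orthonormal basis of $L^2(\mathbb{R})$. Its core space is $V_0=\overline{\operatorname{span}}\{D^nT^l\psi: n<0,\ l\in\mathbb{Z}\}$. For an integer $n\ge 0$ let $\mathcal{G}_n=\{T_{m/2^n}: m\in\mathbb{Z}\}$, let $\mathcal{L}_n$ be the collection of all wavelets whose core space is invariant under $\mathcal{G}_n$ (i.e. mapped into itself by every element of $\mathcal{G}_n$), and let $\mathcal{M}_n=\mathcal{L}_n\setminus\mathcal{L}_{n+1}$. *)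

theory Defs
  imports "HOL-Analysis.Analysis" "HOL-Library.Function_Algebras"
begin

(* Elements of L^2(R) are represented by Borel functions; functions that agree almost
   everywhere are not identified, so l2_norm is only a seminorm on L2R. *)
definition L2R :: "(real \<Rightarrow> complex) set" where
  "L2R = {f \<in> borel_measurable lborel. integrable lborel (\<lambda>x. (cmod (f x))\<^sup>2)}"

definition l2_inner :: "(real \<Rightarrow> complex) \<Rightarrow> (real \<Rightarrow> complex) \<Rightarrow> complex" where
  "l2_inner f g = (\<integral>x. f x * cnj (g x) \<partial>lborel)"

definition l2_norm :: "(real \<Rightarrow> complex) \<Rightarrow> real" where
  "l2_norm f = sqrt (\<integral>x. (cmod (f x))\<^sup>2 \<partial>lborel)"

definition fscale :: "complex \<Rightarrow> (real \<Rightarrow> complex) \<Rightarrow> real \<Rightarrow> complex" where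
  "fscale c f = (\<lambda>x. c * f x)"

interpretation cfun: vector_space fscale
  by unfold_locales (auto simp: fscale_def fun_eq_iff algebra_simps)

(* Closure in the L^2 seminorm: the result is automatically closed under almost
   everywhere equality, i.e. it is a union of full equivalence classes. *)
definition closed_span :: "(real \<Rightarrow> complex) set \<Rightarrow> (real \<Rightarrow> complex) set" where
  "closed_span S = {f \<in> L2R. \<forall>e>0. \<exists>g \<in> cfun.span S. l2_norm (f - g) < e}"

definition orthonormal_basis :: "('i \<Rightarrow> real \<Rightarrow> complex) \<Rightarrow> bool" where
  "orthonormal_basis b \<longleftrightarrow>
     (\<forall>i. b i \<in> L2R) \<and>
     (\<forall>i j. l2_inner (b i) (b j) = (if i = j then 1 else 0)) \<and>
     closed_span (range b) = L2R"

definition dilation :: "(real \<Rightarrow> complex) \<Rightarrow> real \<Rightarrow> complex" where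
  "dilation f = (\<lambda>x. complex_of_real (sqrt 2) * f (2 * x))"

definition translation :: "real \<Rightarrow> (real \<Rightarrow> complex) \<Rightarrow> real \<Rightarrow> complex" where
  "translation a f = (\<lambda>x. f (x - a))"

definition int_iter :: "('a \<Rightarrow> 'a) \<Rightarrow> int \<Rightarrow> 'a \<Rightarrow> 'a" where
  "int_iter F n = (if 0 \<le> n then F ^^ nat n else inv F ^^ nat (- n))"

definition wavelet_system ::
    "(real \<Rightarrow> complex) \<Rightarrow> int \<times> int \<Rightarrow> real \<Rightarrow> complex" where
  "wavelet_system \<psi> = (\<lambda>(n, l). int_iter dilation n (int_iter (translation 1) l \<psi>))"

definition wavelet :: "(real \<Rightarrow> complex) \<Rightarrow> bool" where
  "wavelet \<psi> \<longleftrightarrow> \<psi> \<in> L2R \<and> orthonormal_basis (wavelet_system \<psi>)"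

definition core_space :: "(real \<Rightarrow> complex) \<Rightarrow> (real \<Rightarrow> complex) set" where
  "core_space \<psi> = closed_span {wavelet_system \<psi> (n, l) | n l. n < 0}"

definition translation_group :: "nat \<Rightarrow> ((real \<Rightarrow> complex) \<Rightarrow> real \<Rightarrow> complex) set" where
  "translation_group n = {translation (real_of_int m / 2 ^ n) | m. True}"

definition invariant_under :: "('a \<Rightarrow> 'a) set \<Rightarrow> 'a set \<Rightarrow> bool" where
  "invariant_under G V \<longleftrightarrow> (\<forall>U\<in>G. U ` V \<subseteq> V)"

definition wavelet_class_L :: "nat \<Rightarrow> (real \<Rightarrow> complex) set" where
  "wavelet_class_L n = {\<psi>. wavelet \<psi> \<and> invariant_under (translation_group n) (core_space \<psi>)}"

definition wavelet_class_M :: "nat \<Rightarrow> (real \<Rightarrow> complex) set" where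
  "wavelet_class_M n = wavelet_class_L n - wavelet_class_L (n + 1)"

(* Dilation and translation are bijective on all functions, so the use of inv in int_iter
   yields the genuine inverse operators and hence the usual explicit formulas. *)

lemma inv_dilation: "inv dilation f = (\<lambda>x. f (x / 2) / complex_of_real (sqrt 2))"
proof -
  have "inj dilation"
  proof (rule injI)
    fix f g assume "dilation f = dilation g"
    then have "f (2 * (x / 2)) = g (2 * (x / 2))" for x
      unfolding dilation_def fun_eq_iff by (metis mult_cancel_left of_real_eq_0_iff
          real_sqrt_eq_zero_cancel_iff zero_neq_numeral)
    then show "f = g" by (simp add: fun_eq_iff)
  qed
  then show ?thesis
    by (rule inv_f_eq) (simp add: dilation_def)
qed

lemma inv_translation: "inv (translation a) = translation (- a)"
  by (rule inv_unique_comp) (auto simp: translation_def fun_eq_iff)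

lemma int_iter_dilation:
  "int_iter dilation n f = (\<lambda>x. complex_of_real (sqrt 2) powi n * f (2 powi n * x))"
proof -
  have "(dilation ^^ k) f = (\<lambda>x. complex_of_real (sqrt 2) ^ k * f (2 ^ k * x))" for k
    by (induction k) (auto simp: dilation_def fun_eq_iff mult_ac)
  moreover have "(inv dilation ^^ k) f =
      (\<lambda>x. inverse (complex_of_real (sqrt 2)) ^ k * f (inverse 2 ^ k * x))" for k
    by (induction k) (auto simp: inv_dilation fun_eq_iff field_simps)
  ultimately show ?thesis by (simp add: int_iter_def power_int_def)
qed

lemma int_iter_translation:
  "int_iter (translation a) l f = (\<lambda>x. f (x - real_of_int l * a))"
proof -
  have "(translation b ^^ k) f = (\<lambda>x. f (x - real k * b))" for b k
    by (induction k) (auto simp: translation_def fun_eq_iff algebra_simps)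
  then show ?thesis by (simp add: int_iter_def inv_translation)
qed

end

theory Submission
  imports Defs
begin

text \<open>Measure frequency in cycles, put \<open>N = 2^n\<close> and \<open>c = N / (4 N - 1)\<close>. The symmetric set
  with positive part \<open>(c, 1/2] \<union> (N, N + c]\<close> tiles the line both by integer translations and by
  powers of two. It contains \<open>A + N\<close> and \<open>2 A\<close> for \<open>A = (c/2, 1/4]\<close>. Interpolating between this
  wavelet set and the one in which these two pieces are replaced by \<open>A\<close> and \<open>2 (A + N)\<close> gives
  a wavelet whose transform is \<open>1 / sqrt 2\<close> on \<open>A\<close>, \<open>A + N\<close>, \<open>2 A\<close>, is \<open>- 1 / sqrt 2\<close> on
  \<open>2 (A + N)\<close>, and is \<open>1\<close> on the rest of the set.

  Frequencies of the support that agree modulo 1 agree modulo \<open>N\<close>. Hence modulation by a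
  character of frequency \<open>m / N\<close> acts on the support like multiplication by a 1-periodic function,
  so the span of the integer translates of the wavelet is invariant under translation by \<open>m / N\<close>,
  and with it all \<open>W\<^sub>j\<close>, \<open>j \<ge> 0\<close>, and the orthogonal complement \<open>V\<^sub>0\<close> of their sum.
  Translation by \<open>1 / (2 N)\<close> takes opposite signs on \<open>A\<close> and \<open>A + N\<close>, which turns the
  cancellation giving \<open>D\<inverse> \<psi> \<bottom> \<psi>\<close> into a non-zero inner product.\<close>

text \<open>A wavelet whose transform is the indicator of a wavelet set is no candidate: each of its
  levels consists of all functions with spectrum in a fixed set, so its core space is invariant
  under every translation. The generator has to tie frequencies together, so that a translation with
  different phases at tied points is noticed. Every tie has length a multiple of \<open>N\<close>,
  which gives the invariance under steps \<open>1 / N\<close>; the tie between \<open>A\<close> and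
  \<open>A + N\<close> has length exactly \<open>N\<close>, which stops it there. The constant is
  forced by the dyadic tiling: dividing \<open>(N, N + c]\<close> by \<open>4 N\<close> gives
  \<open>(1/4, (N + c) / (4 N)]\<close>, which together with \<open>(c, 1/2]\<close> is an octave
  exactly when \<open>4 N c = N + c\<close>. Orthogonality of different levels comes down to the
  product of the transform at \<open>x\<close> and at \<open>2^j x\<close>. Completeness is obtained
  on the frequency side, by producing the indicators of all intervals.\<close>

section \<open>The \<open>L\<^sup>2\<close> seminorm and closed spans\<close>

text \<open>With these rules the simplifier eta-expands sums of functions below \<open>l2_inner\<close> and
  \<open>closed_span\<close>, and the lemmas about them no longer match.\<close>

declare plus_fun_apply [simp del] zero_fun_apply [simp del] minus_apply [simp del]
  times_fun_apply [simp del]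

lemma L2R_measurable [measurable_dest]: "f \<in> L2R \<Longrightarrow> f \<in> borel_measurable borel"
  by (simp add: L2R_def)

lemma L2R_sq_integrable: "f \<in> L2R \<Longrightarrow> integrable lborel (\<lambda>x. (cmod (f x))\<^sup>2)"
  by (simp add: L2R_def)

lemma L2R_bound:
  assumes "g \<in> L2R" "f \<in> borel_measurable borel" "\<And>x. cmod (f x) \<le> C * cmod (g x)"
  shows "f \<in> L2R"
proof -
  have "integrable lborel (\<lambda>x. C\<^sup>2 * (cmod (g x))\<^sup>2)"
    using L2R_sq_integrable[OF assms(1)] by simp
  then have "integrable lborel (\<lambda>x. (cmod (f x))\<^sup>2)"
  proof (rule Bochner_Integration.integrable_bound)
    show "AE x in lborel. norm ((cmod (f x))\<^sup>2) \<le> norm (C\<^sup>2 * (cmod (g x))\<^sup>2)"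
      using power_mono[OF assms(3) norm_ge_zero, of _ 2] by (auto simp: power_mult_distrib)
  qed (use assms in simp)
  with assms(2) show ?thesis by (simp add: L2R_def)
qed

lemma L2R_zero [simp]: "0 \<in> L2R" "(\<lambda>x. 0) \<in> L2R"
  by (simp_all add: L2R_def zero_fun_def)

lemma L2R_fscale: "f \<in> L2R \<Longrightarrow> fscale c f \<in> L2R"
  by (rule L2R_bound[where C = "cmod c" and g = f]) (auto simp: fscale_def norm_mult L2R_def)

lemma L2R_add:
  assumes "f \<in> L2R" "g \<in> L2R" shows "f + g \<in> L2R"
proof -
  have [measurable]: "f \<in> borel_measurable borel" "g \<in> borel_measurable borel"
    using assms by (auto simp: L2R_def)
  have "integrable lborel (\<lambda>x. 2 * ((cmod (f x))\<^sup>2 + (cmod (g x))\<^sup>2))"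
    using assms by (simp add: L2R_def)
  then have "integrable lborel (\<lambda>x. (cmod ((f + g) x))\<^sup>2)"
  proof (rule Bochner_Integration.integrable_bound)
    have "(cmod (u + v))\<^sup>2 \<le> 2 * ((cmod u)\<^sup>2 + (cmod v)\<^sup>2)" for u v
    proof -
      have "(cmod (u + v))\<^sup>2 \<le> (cmod u + cmod v)\<^sup>2"
        by (intro power_mono norm_triangle_ineq) auto
      also have "\<dots> \<le> 2 * ((cmod u)\<^sup>2 + (cmod v)\<^sup>2)"
        using zero_le_power2[of "cmod u - cmod v"] by (simp add: power2_eq_square algebra_simps)
      finally show ?thesis .
    qed
    then show "AE x in lborel. norm ((cmod ((f + g) x))\<^sup>2)
        \<le> norm (2 * ((cmod (f x))\<^sup>2 + (cmod (g x))\<^sup>2))" by (auto simp: plus_fun_apply)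
  qed (simp add: plus_fun_def)
  then show ?thesis by (simp add: L2R_def plus_fun_def)
qed

lemma fscale_minus_one: "fscale (-1) f = - f"
  by (auto simp: fscale_def)

lemma L2R_diff: "f \<in> L2R \<Longrightarrow> g \<in> L2R \<Longrightarrow> f - g \<in> L2R"
  using L2R_add[of f "fscale (-1) g"] L2R_fscale[of g "-1"] by (simp add: fscale_minus_one)

lemma subspace_L2R: "cfun.subspace L2R"
  by (simp add: cfun.subspace_def L2R_add L2R_fscale)

lemma L2R_span: "S \<subseteq> L2R \<Longrightarrow> cfun.span S \<subseteq> L2R"
  by (rule cfun.span_minimal[OF _ subspace_L2R])

lemma L2R_mult_bounded:
  assumes "f \<in> L2R" "h \<in> borel_measurable borel" "\<And>x. cmod (h x) \<le> C"
  shows "(\<lambda>x. h x * f x) \<in> L2R"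
  by (rule L2R_bound[where C = C and g = f])
    (use assms in \<open>auto simp: norm_mult L2R_def intro: mult_right_mono\<close>)

lemma L2R_indicator:
  assumes "A \<in> sets borel" "emeasure lborel A < \<infinity>"
  shows "(indicator A :: real \<Rightarrow> complex) \<in> L2R"
proof -
  have "(\<lambda>x. (cmod (indicator A x))\<^sup>2) = (\<lambda>x. indicator A x :: real)"
    by (auto simp: indicator_def)
  then show ?thesis using assms by (simp add: L2R_def integrable_indicator_iff)
qed

lemma L2R_inner_integrable:
  assumes "f \<in> L2R" "g \<in> L2R"
  shows "integrable lborel (\<lambda>x. f x * cnj (g x))"
proof -
  have [measurable]: "f \<in> borel_measurable borel" "g \<in> borel_measurable borel"
    using assms by (auto simp: L2R_def)
  have "integrable lborel (\<lambda>x. (cmod (f x))\<^sup>2 + (cmod (g x))\<^sup>2)"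
    using assms by (simp add: L2R_def)
  then show ?thesis
  proof (rule Bochner_Integration.integrable_bound)
    have "u * v \<le> u\<^sup>2 + v\<^sup>2" if "u \<ge> 0" "v \<ge> 0" for u v :: real
    proof -
      have "2 * (u * v) \<le> u\<^sup>2 + v\<^sup>2"
        using zero_le_power2[of "u - v"] by (simp add: power2_eq_square algebra_simps)
      moreover have "0 \<le> u * v" using that by simp
      ultimately show ?thesis by linarith
    qed
    then show "AE x in lborel. norm (f x * cnj (g x)) \<le> norm ((cmod (f x))\<^sup>2 + (cmod (g x))\<^sup>2)"
      by (auto simp: norm_mult)
    have "(\<lambda>x. cnj (g x)) \<in> borel_measurable borel"
      by (rule borel_measurable_continuous_on[where f = cnj]) (auto intro: continuous_intros)
    then show "(\<lambda>x. f x * cnj (g x)) \<in> borel_measurable lborel" by simp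
  qed
qed

lemma l2_inner_cnj: "cnj (l2_inner f g) = l2_inner g f"
  unfolding l2_inner_def by (subst Bochner_Integration.integral_cnj[symmetric]) (simp add: mult.commute)

lemma l2_inner_add_left:
  "f \<in> L2R \<Longrightarrow> g \<in> L2R \<Longrightarrow> h \<in> L2R \<Longrightarrow> l2_inner (f + g) h = l2_inner f h + l2_inner g h"
  unfolding l2_inner_def
  by (subst Bochner_Integration.integral_add[symmetric])
    (auto simp: L2R_inner_integrable algebra_simps plus_fun_apply)

lemma l2_inner_fscale_left: "l2_inner (fscale c f) h = c * l2_inner f h"
  by (simp add: l2_inner_def fscale_def mult.assoc)

lemma l2_inner_fscale_right: "l2_inner f (fscale c h) = cnj c * l2_inner f h"
  by (simp add: l2_inner_def fscale_def mult.left_commute)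

lemma l2_inner_add_right:
  "f \<in> L2R \<Longrightarrow> g \<in> L2R \<Longrightarrow> h \<in> L2R \<Longrightarrow> l2_inner h (f + g) = l2_inner h f + l2_inner h g"
  by (metis l2_inner_add_left l2_inner_cnj complex_cnj_add)

lemma l2_inner_diff_left:
  "f \<in> L2R \<Longrightarrow> g \<in> L2R \<Longrightarrow> h \<in> L2R \<Longrightarrow> l2_inner (f - g) h = l2_inner f h - l2_inner g h"
  unfolding l2_inner_def
  by (subst Bochner_Integration.integral_diff[symmetric])
    (auto simp: L2R_inner_integrable algebra_simps minus_apply)

lemma l2_inner_zero [simp]: "l2_inner 0 f = 0" "l2_inner f 0 = 0"
  by (simp_all add: l2_inner_def zero_fun_def)

lemma L2R_sum: "(\<And>i. i \<in> A \<Longrightarrow> f i \<in> L2R) \<Longrightarrow> sum f A \<in> L2R"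
  by (rule cfun.subspace_sum[OF subspace_L2R])

lemma l2_inner_sum_left:
  assumes "\<And>i. i \<in> A \<Longrightarrow> f i \<in> L2R" "h \<in> L2R"
  shows "l2_inner (sum f A) h = (\<Sum>i\<in>A. l2_inner (f i) h)"
  using assms(1)
proof (induction A rule: infinite_finite_induct)
  case (insert x F)
  have "l2_inner (f x + sum f F) h = l2_inner (f x) h + l2_inner (sum f F) h"
    using insert.prems assms(2) by (intro l2_inner_add_left L2R_sum) auto
  then show ?case using insert by (metis insertCI sum.insert)
qed auto

lemma l2_norm_nonneg [simp]: "0 \<le> l2_norm f"
  by (simp add: l2_norm_def)

lemma l2_norm_sq: "(l2_norm f)\<^sup>2 = (\<integral>x. (cmod (f x))\<^sup>2 \<partial>lborel)"
  by (simp add: l2_norm_def)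

lemma l2_inner_self: "l2_inner f f = of_real ((l2_norm f)\<^sup>2)"
  unfolding l2_norm_sq l2_inner_def complex_norm_square[symmetric]
  by (simp flip: integral_complex_of_real)

lemma l2_norm_add_sq:
  assumes "f \<in> L2R" "g \<in> L2R"
  shows "(l2_norm (f + g))\<^sup>2 = (l2_norm f)\<^sup>2 + (l2_norm g)\<^sup>2 + 2 * Re (l2_inner f g)"
proof -
  have "complex_of_real ((l2_norm (f + g))\<^sup>2)
      = l2_inner f f + l2_inner g g + (l2_inner f g + cnj (l2_inner f g))"
    using l2_inner_add_left[OF assms L2R_add[OF assms]] l2_inner_add_right[OF assms assms(1)]
      l2_inner_add_right[OF assms assms(2)] unfolding l2_inner_self[symmetric] l2_inner_cnj
    by (simp only: ac_simps)
  also have "\<dots> = of_real ((l2_norm f)\<^sup>2 + (l2_norm g)\<^sup>2 + 2 * Re (l2_inner f g))"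
    by (simp add: l2_inner_self complex_add_cnj)
  finally show ?thesis by (simp only: of_real_eq_iff)
qed

lemma l2_norm_fscale: "l2_norm (fscale c f) = cmod c * l2_norm f"
  by (simp add: l2_norm_def fscale_def norm_mult power_mult_distrib real_sqrt_mult)

lemma l2_norm_zero [simp]: "l2_norm 0 = 0"
  by (simp add: l2_norm_def zero_fun_def)

lemma l2_norm_diff_sq:
  assumes "f \<in> L2R" "g \<in> L2R"
  shows "(l2_norm (f - g))\<^sup>2 = (l2_norm f)\<^sup>2 + (l2_norm g)\<^sup>2 - 2 * Re (l2_inner f g)"
  using l2_norm_add_sq[OF assms(1) L2R_fscale[OF assms(2), of "-1"]]
  unfolding l2_inner_fscale_right l2_norm_fscale by (simp add: fscale_minus_one fun_diff_def)

lemma l2_cauchy_schwarz: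
  assumes "f \<in> L2R" "g \<in> L2R"
  shows "cmod (l2_inner f g) \<le> l2_norm f * l2_norm g"
proof (cases "l2_norm g = 0")
  case True
  have "AE x in lborel. (cmod (g x))\<^sup>2 = 0"
    using True L2R_sq_integrable[OF assms(2)]
    by (subst integral_nonneg_eq_0_iff_AE[symmetric]) (auto simp: l2_norm_def)
  then have "AE x in lborel. f x * cnj (g x) = 0" by auto
  then have "l2_inner f g = 0"
    unfolding l2_inner_def by (rule integral_eq_zero_AE)
  then show ?thesis by simp
next
  case False
  \<comment> \<open>\<open>fscale c g\<close> is the orthogonal projection of \<open>f\<close> onto
    the line through \<open>g\<close>; the inequality says that the remainder has non-negative
    norm.\<close>
  define c where "c = l2_inner f g / of_real ((l2_norm g)\<^sup>2)"
  have "0 \<le> (l2_norm (f - fscale c g))\<^sup>2" by simp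
  also have "\<dots> = (l2_norm f)\<^sup>2 + (cmod c * l2_norm g)\<^sup>2 - 2 * Re (cnj c * l2_inner f g)"
    using assms by (simp add: l2_norm_diff_sq L2R_fscale l2_norm_fscale l2_inner_fscale_right)
  also have "(cmod c * l2_norm g)\<^sup>2 = (cmod (l2_inner f g))\<^sup>2 / (l2_norm g)\<^sup>2"
    using False unfolding c_def norm_divide norm_of_real by (simp add: field_simps power2_eq_square)
  also have "cnj c * l2_inner f g = of_real ((cmod (l2_inner f g))\<^sup>2 / (l2_norm g)\<^sup>2)"
    unfolding of_real_divide complex_norm_square c_def by (simp add: mult.commute)
  finally have "(cmod (l2_inner f g))\<^sup>2 / (l2_norm g)\<^sup>2 \<le> (l2_norm f)\<^sup>2" by simp
  then have "(cmod (l2_inner f g))\<^sup>2 \<le> (l2_norm f * l2_norm g)\<^sup>2"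
    using False by (simp add: field_simps power_mult_distrib)
  then show ?thesis by (rule power2_le_imp_le) simp
qed

lemma l2_norm_triangle:
  assumes "f \<in> L2R" "g \<in> L2R"
  shows "l2_norm (f + g) \<le> l2_norm f + l2_norm g"
proof (rule power2_le_imp_le)
  have "Re (l2_inner f g) \<le> l2_norm f * l2_norm g"
    using l2_cauchy_schwarz[OF assms] complex_Re_le_cmod order_trans by blast
  then show "(l2_norm (f + g))\<^sup>2 \<le> (l2_norm f + l2_norm g)\<^sup>2"
    using assms by (simp add: l2_norm_add_sq power2_sum)
qed simp

lemma l2_norm_triangle_diff:
  assumes "f \<in> L2R" "g \<in> L2R" "h \<in> L2R"
  shows "l2_norm (f - h) \<le> l2_norm (f - g) + l2_norm (g - h)"
  using l2_norm_triangle[of "f - g" "g - h"] assms by (simp add: L2R_diff)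

lemma l2_norm_le:
  assumes "g \<in> L2R" "f \<in> borel_measurable borel" "\<And>x. cmod (f x) \<le> cmod (g x)"
  shows "l2_norm f \<le> l2_norm g"
  unfolding l2_norm_def
  by (intro real_sqrt_le_mono integral_mono L2R_sq_integrable assms power_mono)
    (use L2R_bound[of g f 1] assms in auto)

lemma l2_norm_sq_nn:
  assumes "f \<in> L2R"
  shows "(\<integral>\<^sup>+x. ennreal ((cmod (f x))\<^sup>2) \<partial>lborel) = ennreal ((l2_norm f)\<^sup>2)"
  unfolding l2_norm_sq by (rule nn_integral_eq_integral) (use L2R_sq_integrable[OF assms] in auto)

lemma L2R_iff_nn:
  "f \<in> L2R \<longleftrightarrow> f \<in> borel_measurable borel \<and> (\<integral>\<^sup>+x. ennreal ((cmod (f x))\<^sup>2) \<partial>lborel) < \<infinity>"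
  by (auto simp: L2R_def integrable_iff_bounded)

lemma l2_norm_eqI:
  assumes "f \<in> L2R" "g \<in> L2R"
    "(\<integral>\<^sup>+x. ennreal ((cmod (f x))\<^sup>2) \<partial>lborel) = (\<integral>\<^sup>+x. ennreal ((cmod (g x))\<^sup>2) \<partial>lborel)"
  shows "l2_norm f = l2_norm g"
  using assms by (simp add: l2_norm_sq_nn)

section \<open>Closed spans, and linear maps between them\<close>

lemma closed_span_L2R: "closed_span S \<subseteq> L2R"
  by (auto simp: closed_span_def)

lemma closed_spanI_span: "f \<in> cfun.span S \<Longrightarrow> f \<in> L2R \<Longrightarrow> f \<in> closed_span S"
  by (auto simp: closed_span_def intro!: bexI[of _ f])

lemma closed_span_base: "f \<in> S \<Longrightarrow> f \<in> L2R \<Longrightarrow> f \<in> closed_span S"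
  by (simp add: closed_spanI_span cfun.span_base)

lemma closed_spanD:
  assumes "f \<in> closed_span S" "e > 0"
  obtains g where "g \<in> cfun.span S" "l2_norm (f - g) < e"
  using assms by (auto simp: closed_span_def)

lemma closed_span_closed:
  assumes S: "S \<subseteq> L2R" and f: "f \<in> L2R"
    and approx: "\<And>e. e > 0 \<Longrightarrow> \<exists>g\<in>closed_span S. l2_norm (f - g) < e"
  shows "f \<in> closed_span S"
  unfolding closed_span_def
proof (intro CollectI conjI allI impI f)
  fix e :: real assume "e > 0"
  then obtain g where g: "g \<in> closed_span S" "l2_norm (f - g) < e / 2"
    using approx[of "e / 2"] by auto
  obtain h where h: "h \<in> cfun.span S" "l2_norm (g - h) < e / 2"
    using closed_spanD[OF g(1), of "e / 2"] \<open>e > 0\<close> by auto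
  have "l2_norm (f - h) \<le> l2_norm (f - g) + l2_norm (g - h)"
    using f g(1) h(1) L2R_span[OF S] closed_span_L2R by (intro l2_norm_triangle_diff) auto
  with g h show "\<exists>h\<in>cfun.span S. l2_norm (f - h) < e" by (intro bexI[of _ h]) auto
qed

lemma subspace_closed_span:
  assumes S: "S \<subseteq> L2R" shows "cfun.subspace (closed_span S)"
  unfolding cfun.subspace_def
proof (intro conjI ballI allI)
  show "0 \<in> closed_span S" by (simp add: closed_spanI_span cfun.span_zero)
next
  fix f g assume f: "f \<in> closed_span S" and g: "g \<in> closed_span S"
  show "f + g \<in> closed_span S"
    unfolding closed_span_def
  proof (intro CollectI conjI allI impI)
    show "f + g \<in> L2R" using f g closed_span_L2R by (blast intro: L2R_add)
    fix e :: real assume e: "e > 0"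
    obtain f' where f': "f' \<in> cfun.span S" "l2_norm (f - f') < e / 2"
      using closed_spanD[OF f, of "e / 2"] e by auto
    obtain g' where g': "g' \<in> cfun.span S" "l2_norm (g - g') < e / 2"
      using closed_spanD[OF g, of "e / 2"] e by auto
    have "l2_norm ((f - f') + (g - g')) \<le> l2_norm (f - f') + l2_norm (g - g')"
      using f f' g g' L2R_span[OF S] closed_span_L2R by (intro l2_norm_triangle L2R_diff) auto
    moreover have "(f - f') + (g - g') = f + g - (f' + g')" by simp
    ultimately show "\<exists>h\<in>cfun.span S. l2_norm (f + g - h) < e"
      using f' g' by (intro bexI[of _ "f' + g'"] cfun.span_add) auto
  qed
next
  fix c f assume f: "f \<in> closed_span S"
  show "fscale c f \<in> closed_span S"
    unfolding closed_span_def
  proof (intro CollectI conjI allI impI)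
    show "fscale c f \<in> L2R" using f closed_span_L2R by (blast intro: L2R_fscale)
    fix e :: real assume e: "e > 0"
    \<comment> \<open>The added 1 keeps the tolerance positive and finite when \<open>c\<close> is
      0.\<close>
    obtain g where g: "g \<in> cfun.span S" "l2_norm (f - g) < e / (cmod c + 1)"
      using closed_spanD[OF f, of "e / (cmod c + 1)"] e
      by (metis divide_pos_pos norm_ge_zero add_nonneg_pos zero_less_one)
    have "l2_norm (fscale c f - fscale c g) = cmod c * l2_norm (f - g)"
      by (simp flip: l2_norm_fscale cfun.scale_right_diff_distrib)
    also have "\<dots> \<le> (cmod c + 1) * l2_norm (f - g)" by (simp add: mult_right_mono)
    also have "\<dots> < e" using g(2) by (simp add: field_simps add_pos_nonneg)
    finally show "\<exists>h\<in>cfun.span S. l2_norm (fscale c f - h) < e"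
      using g by (intro bexI[of _ "fscale c g"] cfun.span_scale) auto
  qed
qed

lemma closed_span_add:
  "S \<subseteq> L2R \<Longrightarrow> f \<in> closed_span S \<Longrightarrow> g \<in> closed_span S \<Longrightarrow> f + g \<in> closed_span S"
  by (rule cfun.subspace_add[OF subspace_closed_span])

lemma closed_span_diff:
  "S \<subseteq> L2R \<Longrightarrow> f \<in> closed_span S \<Longrightarrow> g \<in> closed_span S \<Longrightarrow> f - g \<in> closed_span S"
  by (rule cfun.subspace_diff[OF subspace_closed_span])

lemma closed_span_fscale:
  "S \<subseteq> L2R \<Longrightarrow> f \<in> closed_span S \<Longrightarrow> fscale c f \<in> closed_span S"
  by (rule cfun.subspace_scale[OF subspace_closed_span])

lemma closed_span_mono_closed:
  assumes "S \<subseteq> closed_span S'" "S' \<subseteq> L2R"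
  shows "closed_span S \<subseteq> closed_span S'"
proof
  fix f assume f: "f \<in> closed_span S"
  have "cfun.span S \<subseteq> closed_span S'"
    by (rule cfun.span_minimal[OF assms(1) subspace_closed_span[OF assms(2)]])
  with f show "f \<in> closed_span S'"
    using closed_span_L2R closed_spanD by (intro closed_span_closed[OF assms(2)]) blast+
qed

text \<open>A linear contraction is continuous, so it respects closed spans. It is only assumed to
  behave well on a subspace \<open>B\<close>, since the Fourier integral below is linear and
  isometric on functions of bounded support; the approximants lie in \<open>B\<close> because
  \<open>S\<close> does.\<close>

lemma closed_span_image:
  assumes B: "cfun.subspace B" "B \<subseteq> L2R" and S: "S \<subseteq> B"
    and f: "f \<in> B" "f \<in> closed_span S"
    and add: "\<And>g h. g \<in> B \<Longrightarrow> h \<in> B \<Longrightarrow> \<Phi> (g + h) = \<Phi> g + \<Phi> h"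
    and scale: "\<And>c g. g \<in> B \<Longrightarrow> \<Phi> (fscale c g) = fscale c (\<Phi> g)"
    and L2: "\<And>g. g \<in> B \<Longrightarrow> \<Phi> g \<in> L2R"
    and norm: "\<And>g. g \<in> B \<Longrightarrow> l2_norm (\<Phi> g) \<le> l2_norm g"
  shows "\<Phi> f \<in> closed_span (\<Phi> ` S)"
proof -
  have "0 \<in> B" using B(1) by (simp add: cfun.subspace_def)
  then have z: "\<Phi> 0 = 0" using scale[of 0 0] by (simp add: fscale_def zero_fun_def)
  have sp: "\<Phi> g \<in> cfun.span (\<Phi> ` S) \<and> g \<in> B" if "g \<in> cfun.span S" for g
    using that
  proof (induction rule: cfun.span_induct_alt)
    case base then show ?case using z \<open>0 \<in> B\<close> by (simp add: cfun.span_zero)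
  next
    case (step c x y)
    then have "x \<in> B" using S by auto
    then have "fscale c x \<in> B" using B(1) by (simp add: cfun.subspace_def)
    with step \<open>x \<in> B\<close> show ?case
      using add[of "fscale c x" y] scale[of x c] cfun.subspace_add[OF B(1)]
      by (auto intro!: cfun.span_add cfun.span_scale intro: cfun.span_base)
  qed
  show ?thesis
    unfolding closed_span_def
  proof (intro CollectI conjI allI impI L2 f)
    fix e :: real assume "e > 0"
    then obtain g where g: "g \<in> cfun.span S" "l2_norm (f - g) < e"
      using f(2) closed_spanD by blast
    have gB: "g \<in> B" using sp[OF g(1)] by simp
    have fg: "f - g \<in> B" using B(1) f(1) gB by (rule cfun.subspace_diff)
    have "\<Phi> f = \<Phi> (f - g) + \<Phi> g" using add[OF fg gB] by simp
    then have "l2_norm (\<Phi> f - \<Phi> g) \<le> l2_norm (f - g)" using norm[OF fg] by simp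
    then show "\<exists>h\<in>cfun.span (\<Phi> ` S). l2_norm (\<Phi> f - h) < e"
      using g sp[OF g(1)] by (intro bexI[of _ "\<Phi> g"]) auto
  qed
qed

lemmas closed_span_image_L2R = closed_span_image[OF subspace_L2R order_refl]

lemma l2_inner_closed_span_zero:
  assumes S: "S \<subseteq> L2R" and h: "h \<in> L2R" and f: "f \<in> closed_span S"
    and orth: "\<And>g. g \<in> S \<Longrightarrow> l2_inner g h = 0"
  shows "l2_inner f h = 0"
proof (rule ccontr)
  assume nz: "l2_inner f h \<noteq> 0"
  have sp: "l2_inner g h = 0 \<and> g \<in> L2R" if "g \<in> cfun.span S" for g
    using that
  proof (induction rule: cfun.span_induct_alt)
    case (step c x y)
    then show ?case using S h orth
      by (auto simp: l2_inner_add_left L2R_add L2R_fscale l2_inner_fscale_left subset_iff)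
  qed auto
  \<comment> \<open>By Cauchy-Schwarz an approximation this close would make the inner product
    smaller than itself. The added 1 covers the case that \<open>h\<close> has seminorm 0.\<close>
  define e where "e = cmod (l2_inner f h) / (l2_norm h + 1)"
  have "e > 0" using nz by (simp add: e_def add_nonneg_pos)
  then obtain g where g: "g \<in> cfun.span S" "l2_norm (f - g) < e"
    using f closed_spanD by blast
  have fL: "f \<in> L2R" using f closed_span_L2R by blast
  have "cmod (l2_inner f h) = cmod (l2_inner (f - g) h)"
    using sp[OF g(1)] fL h by (simp add: l2_inner_diff_left)
  also have "\<dots> \<le> l2_norm (f - g) * l2_norm h"
    using sp[OF g(1)] fL h by (intro l2_cauchy_schwarz L2R_diff) auto
  also have "\<dots> \<le> l2_norm (f - g) * (l2_norm h + 1)"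
    by (intro mult_left_mono) auto
  also have "\<dots> < e * (l2_norm h + 1)"
    using g(2) by (intro mult_strict_right_mono) (auto simp: add_nonneg_pos)
  also have "\<dots> = cmod (l2_inner f h)"
    using l2_norm_nonneg[of h] by (simp add: e_def add_nonneg_eq_0_iff)
  finally show False by simp
qed

text \<open>Polarization: norms of sums determine the real part of the inner product, and replacing
  \<open>g\<close> by \<open>fscale \<i> g\<close> gives the imaginary part.\<close>

lemma l2_inner_isometry:
  assumes B: "cfun.subspace B" "B \<subseteq> L2R" and fg: "f \<in> B" "g \<in> B"
    and add: "\<And>g h. g \<in> B \<Longrightarrow> h \<in> B \<Longrightarrow> \<Phi> (g + h) = \<Phi> g + \<Phi> h"
    and scale: "\<And>c g. g \<in> B \<Longrightarrow> \<Phi> (fscale c g) = fscale c (\<Phi> g)"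
    and L2: "\<And>g. g \<in> B \<Longrightarrow> \<Phi> g \<in> L2R"
    and norm: "\<And>g. g \<in> B \<Longrightarrow> l2_norm (\<Phi> g) = l2_norm g"
  shows "l2_inner (\<Phi> f) (\<Phi> g) = l2_inner f g"
proof -
  have re: "Re (l2_inner (\<Phi> f) (\<Phi> g)) = Re (l2_inner f g)" if "f \<in> B" "g \<in> B" for f g
  proof -
    have "f + g \<in> B" using that B(1) by (simp add: cfun.subspace_add)
    then have "(l2_norm (\<Phi> f + \<Phi> g))\<^sup>2 = (l2_norm (f + g))\<^sup>2"
      using add[OF that] norm by metis
    then show ?thesis
      using l2_norm_add_sq[of f g] l2_norm_add_sq[of "\<Phi> f" "\<Phi> g"] that L2 norm[of f] norm[of g]
        subsetD[OF B(2), of f] subsetD[OF B(2), of g]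
      by auto
  qed
  have "fscale \<i> g \<in> B" using fg B(1) by (simp add: cfun.subspace_scale)
  then have "Re (l2_inner (\<Phi> f) (fscale \<i> (\<Phi> g))) = Re (l2_inner f (fscale \<i> g))"
    using re[of f "fscale \<i> g"] fg scale[of g \<i>] by simp
  then have "Im (l2_inner (\<Phi> f) (\<Phi> g)) = Im (l2_inner f g)"
    by (simp add: l2_inner_fscale_right)
  with re[OF fg] show ?thesis by (simp add: complex_eq_iff)
qed

section \<open>Density of step functions and Parseval's identity\<close>

text \<open>Dominated convergence for squares: both the limit and the sequence are bounded by
  \<open>h\<close>, so the squared error is at most four times the square of
  \<open>h\<close>.\<close>

lemma L2R_dominated:
  assumes h: "h \<in> L2R" and f: "f \<in> borel_measurable borel"
    and bd: "\<And>k x. cmod (u k x) \<le> cmod (h x)" and lim: "\<And>x. (\<lambda>k. u k x) \<longlonglongrightarrow> f x"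
    and u: "\<And>k. u k \<in> borel_measurable borel"
  shows "f \<in> L2R" "(\<lambda>k. l2_norm (f - u k)) \<longlonglongrightarrow> 0"
proof -
  have fb: "cmod (f x) \<le> cmod (h x)" for x
    by (rule LIMSEQ_le_const2[OF tendsto_norm[OF lim]]) (use bd in auto)
  then show fL: "f \<in> L2R" using L2R_bound[OF h f, of 1] by simp
  have "(\<lambda>k. \<integral>x. (cmod ((f - u k) x))\<^sup>2 \<partial>lborel) \<longlonglongrightarrow> (\<integral>x. 0 \<partial>(lborel :: real measure))"
  proof (rule integral_dominated_convergence)
    show "integrable lborel (\<lambda>x. 4 * (cmod (h x))\<^sup>2)" using L2R_sq_integrable[OF h] by simp
    have "(\<lambda>k. (cmod (f x - u k x))\<^sup>2) \<longlonglongrightarrow> (cmod (f x - f x))\<^sup>2" for x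
      by (intro tendsto_intros lim)
    then show "AE x in lborel. (\<lambda>k. (cmod ((f - u k) x))\<^sup>2) \<longlonglongrightarrow> 0"
      by (simp add: minus_apply)
    have "cmod (f x - u k x) \<le> 2 * cmod (h x)" for k x
      using norm_triangle_ineq4[of "f x" "u k x"] fb[of x] bd[of k x] by linarith
    then have "(cmod (f x - u k x))\<^sup>2 \<le> (2 * cmod (h x))\<^sup>2" for k x
      by (intro power_mono) auto
    then show "AE x in lborel. norm ((cmod ((f - u k) x))\<^sup>2) \<le> 4 * (cmod (h x))\<^sup>2" for k
      by (simp add: power_mult_distrib minus_apply)
    show "(\<lambda>x. (cmod ((f - u k) x))\<^sup>2) \<in> borel_measurable lborel" for k
      using f u[of k] by (simp add: fun_diff_def)
  qed simp
  then have "(\<lambda>k. sqrt (\<integral>x. (cmod ((f - u k) x))\<^sup>2 \<partial>lborel)) \<longlonglongrightarrow> sqrt 0"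
    by (intro tendsto_real_sqrt) simp
  then show "(\<lambda>k. l2_norm (f - u k)) \<longlonglongrightarrow> 0" by (simp add: l2_norm_def)
qed

lemma closed_span_limit:
  assumes S: "S \<subseteq> L2R" and f: "f \<in> L2R" and u: "\<And>k. u k \<in> closed_span S"
    and lim: "(\<lambda>k. l2_norm (f - u k)) \<longlonglongrightarrow> 0"
  shows "f \<in> closed_span S"
proof (rule closed_span_closed[OF S f])
  fix e :: real assume "e > 0"
  with lim have "\<forall>\<^sub>F k in sequentially. l2_norm (f - u k) < e"
    by (rule order_tendstoD)
  then obtain k where "l2_norm (f - u k) < e" by (metis eventually_happens sequentially_bot)
  with u show "\<exists>g\<in>closed_span S. l2_norm (f - g) < e" by blast
qed

lemma closed_span_dominated:
  assumes "S \<subseteq> L2R" "h \<in> L2R" "f \<in> borel_measurable borel" "\<And>k. u k \<in> closed_span S"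
    "\<And>k x. cmod (u k x) \<le> cmod (h x)" "\<And>x. (\<lambda>k. u k x) \<longlonglongrightarrow> f x"
  shows "f \<in> closed_span S"
proof -
  have "u k \<in> borel_measurable borel" for k
    using assms(4)[of k] closed_span_L2R by (auto simp: L2R_def)
  from L2R_dominated[OF assms(2,3,5,6) this] show ?thesis
    by (intro closed_span_limit[OF assms(1) _ assms(4)])
qed

text \<open>Elements of \<open>L2R\<close> are functions, not classes. Limits constructed below hit
  their target only up to an endpoint or the point 0, and this closes the gap.\<close>

lemma closed_span_AE:
  assumes S: "S \<subseteq> L2R" and f: "f \<in> closed_span S" and g: "g \<in> borel_measurable borel"
    and ae: "AE x in lborel. f x = g x"
  shows "g \<in> closed_span S"
proof (rule closed_span_closed[OF S])
  have [measurable]: "f \<in> borel_measurable borel" using f closed_span_L2R by (auto simp: L2R_def)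
  note [measurable] = g
  have fL: "f \<in> L2R" using f closed_span_L2R by blast
  have "integrable lborel (\<lambda>x. (cmod (f x))\<^sup>2) \<longleftrightarrow> integrable lborel (\<lambda>x. (cmod (g x))\<^sup>2)"
    by (rule integrable_cong_AE) (use ae in auto)
  with fL g show "g \<in> L2R" by (simp add: L2R_def)
  have "(\<integral>x. (cmod ((g - f) x))\<^sup>2 \<partial>lborel) = 0"
    by (rule integral_eq_zero_AE) (use ae in \<open>auto simp: minus_apply\<close>)
  then have "l2_norm (g - f) = 0" by (simp add: l2_norm_def)
  then show "\<exists>h\<in>closed_span S. l2_norm (g - h) < e" if "e > 0" for e
    using f that by (metis (no_types))
qed

lemma closed_span_sum:
  "S \<subseteq> L2R \<Longrightarrow> (\<And>i. i \<in> A \<Longrightarrow> u i \<in> closed_span S) \<Longrightarrow> sum u A \<in> closed_span S"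
  by (rule cfun.subspace_sum[OF subspace_closed_span])

lemma sum_fun_eval: "sum u A x = (\<Sum>i\<in>A. u i x)"
  by (induction A rule: infinite_finite_induct) (auto simp: zero_fun_apply plus_fun_apply)

lemma L2R_indicator_Ioc: "(indicator {a<..b} :: real \<Rightarrow> complex) \<in> L2R"
  by (cases "a \<le> b") (auto intro!: L2R_indicator)

text \<open>Half-open intervals are stable under intersection and generate the Borel sets, and the
  property survives complements and countable disjoint unions. The fixed window keeps all indicators
  in \<open>L2R\<close> and serves as the majorant in the union step.\<close>

lemma closed_span_indicator_bounded_borel:
  assumes S: "S \<subseteq> L2R"
    and Ioc: "\<And>x y. x < y \<Longrightarrow> indicator {x<..y} \<in> closed_span S"
    and A: "A \<in> sets borel"
  shows "indicator (A \<inter> {-R<..R}) \<in> closed_span S"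
proof -
  define G where "G = range (\<lambda>(a, b). {a <.. b::real})"
  let ?J = "{-R<..R}"
  have Gst: "Int_stable G"
  proof (rule Int_stableI)
    fix a b assume "a \<in> G" "b \<in> G"
    then obtain x y z w where "a = {x<..y}" "b = {z<..w}" by (auto simp: G_def)
    then have "a \<inter> b = (\<lambda>(a, b). {a <.. b}) (max x z, min y w)" by auto
    then show "a \<inter> b \<in> G" unfolding G_def by blast
  qed
  have Ioc': "(indicator {x<..y} :: real \<Rightarrow> complex) \<in> closed_span S" for x y
  proof (cases "x < y")
    case False
    then have "(indicator {x<..y} :: real \<Rightarrow> complex) = 0"
      by (auto simp: fun_eq_iff zero_fun_apply)
    then show ?thesis
      using cfun.subspace_0[OF subspace_closed_span[OF S]] by simp
  qed (rule Ioc)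
  have AG: "A \<in> sigma_sets UNIV G"
    using A unfolding borel_sigma_sets_Ioc G_def by simp
  have GP: "G \<subseteq> Pow UNIV" by simp
  from Gst GP AG show ?thesis
  proof (induction rule: sigma_sets_induct_disjoint)
    case (basic A)
    then obtain x y where "A = {x<..y}" by (auto simp: G_def)
    then have "A \<inter> ?J = {max x (-R)<..min y R}" by auto
    then show ?case using Ioc' by simp
  next
    case empty
    have "{} \<inter> ?J = {0<..0}" by simp
    then show ?case using Ioc'[of 0 0] by metis
  next
    case (compl A)
    have "indicator ((UNIV - A) \<inter> ?J) = (indicator ?J - indicator (A \<inter> ?J) :: real \<Rightarrow> complex)"
      by (auto simp: fun_eq_iff indicator_def minus_apply)
    then show ?case using closed_span_diff[OF S Ioc' compl(2)] by simp
  next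
    case (union A)
    have bor: "A i \<in> sets borel" for i
      using union(2) unfolding borel_sigma_sets_Ioc G_def by auto
    define u :: "nat \<Rightarrow> real \<Rightarrow> complex" where "u k = indicator ((\<Union>i<k. A i) \<inter> ?J)" for k
    show ?case
    proof (rule closed_span_dominated[where u = u and h = "indicator ?J"])
      have "u k = (\<Sum>i<k. indicator (A i \<inter> ?J))" for k
      proof (induction k)
        case (Suc k)
        have "A k \<inter> A i = {}" if "i < k" for i
          using union(1) that by (auto simp: disjoint_family_on_def)
        then have "u (Suc k) = u k + indicator (A k \<inter> ?J)"
          by (auto simp: u_def fun_eq_iff indicator_def plus_fun_apply lessThan_Suc)
        with Suc show ?case by simp
      qed (simp add: u_def zero_fun_def)
      then show "u k \<in> closed_span S" for k
        using union(3) by (auto intro!: closed_span_sum S)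
      show "cmod (u k x) \<le> cmod (indicator ?J x)" for k x
        by (auto simp: u_def indicator_def)
      show "(\<lambda>k. u k x) \<longlonglongrightarrow> indicator (\<Union> (range A) \<inter> ?J) x" for x
      proof (cases "\<exists>i. x \<in> A i")
        case True
        then obtain i where "x \<in> A i" by blast
        then have "\<forall>\<^sub>F k in sequentially. u k x = indicator (\<Union> (range A) \<inter> ?J) x"
          by (intro eventually_sequentiallyI[of "Suc i"])
            (auto simp: u_def indicator_def Suc_le_eq)
        then show ?thesis by (rule tendsto_eventually)
      qed (auto simp: u_def)
      show "(indicator (\<Union> (range A) \<inter> ?J) :: real \<Rightarrow> complex) \<in> borel_measurable borel"
        using bor by measurable
    qed (use S L2R_indicator_Ioc in auto)
  qed
qed

text \<open>The completeness criterion for the whole development: it is applied to the trigonometric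
  system, to the range of the Fourier integral and to the wavelet system.\<close>

lemma closed_span_eq_L2R:
  assumes S: "S \<subseteq> L2R"
    and Ioc: "\<And>x y. x < y \<Longrightarrow> indicator {x<..y} \<in> closed_span S"
  shows "closed_span S = L2R"
proof (rule antisym[OF closed_span_L2R], rule subsetI)
  fix f :: "real \<Rightarrow> complex" assume f: "f \<in> L2R"
  then have fm: "f \<in> borel_measurable borel" by (simp add: L2R_def)
  from borel_measurable_implies_sequence_metric[OF this, of 0]
  obtain F where F: "\<And>i. simple_function borel (F i)" "\<And>x. (\<lambda>i. F i x) \<longlonglongrightarrow> f x"
    "\<And>i x. cmod (F i x) \<le> 2 * cmod (f x)" by auto
  \<comment> \<open>The growing window makes the level sets of \<open>F i\<close> bounded, as the
    lemma on indicators requires; the factor 2 of the majorant comes from the approximation by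
    simple functions.\<close>
  define u :: "nat \<Rightarrow> real \<Rightarrow> complex"
    where "u i x = indicator {- real i<..real i} x * F i x" for i x
  show "f \<in> closed_span S"
  proof (rule closed_span_dominated[where u = u and h = "fscale 2 f", OF S L2R_fscale[OF f] fm])
    show "cmod (u k x) \<le> cmod (fscale 2 f x)" for k x
      using F(3)[of k x] by (auto simp: u_def fscale_def norm_mult indicator_def)
    show "(\<lambda>k. u k x) \<longlonglongrightarrow> f x" for x
    proof -
      obtain n where n: "\<bar>x\<bar> < real n" using reals_Archimedean2 by blast
      then have "\<forall>\<^sub>F k in sequentially. u k x = F k x"
        by (intro eventually_sequentiallyI[of n]) (auto simp: u_def indicator_def)
      then show ?thesis using F(2) by (subst tendsto_cong)
    qed
    show "u i \<in> closed_span S" for i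
    proof -
      let ?A = "\<lambda>y. F i -` {y}"
      have fin: "finite (range (F i))" and bor: "\<And>y. ?A y \<in> sets borel"
        using F(1)[of i] by (auto simp: simple_function_def)
          (metis (no_types, lifting) F(1) borel_measurable_simple_function inf_top.right_neutral
            measurable_sets_borel borel_singleton sets.empty_sets)
      have "u i = (\<Sum>y\<in>range (F i). fscale y (indicator (?A y \<inter> {- real i<..real i})))"
      proof
        fix x
        have "(\<Sum>y\<in>range (F i). fscale y (indicator (?A y \<inter> {- real i<..real i})) x)
          = (\<Sum>y\<in>range (F i). if y = F i x then u i x else 0)"
          by (intro sum.cong refl) (auto simp: fscale_def u_def indicator_def)
        also have "\<dots> = u i x" using fin by (subst sum.delta) auto
        finally show "u i x = sum (\<lambda>y. fscale y (indicator (?A y \<inter> {- real i<..real i}))) (range (F i)) x"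
          by (simp add: sum_fun_eval)
      qed
      then show ?thesis
        using closed_span_indicator_bounded_borel[OF S Ioc bor]
        by (auto intro!: closed_span_sum closed_span_fscale S)
    qed
  qed
qed

section \<open>Parseval's identity and periodization\<close>

lemma parseval:
  fixes b :: "nat \<Rightarrow> real \<Rightarrow> complex"
  assumes b: "\<And>i. b i \<in> L2R" and on: "\<And>i j. l2_inner (b i) (b j) = (if i = j then 1 else 0)"
    and f: "f \<in> closed_span (range b)"
  shows "(\<Sum>i. ennreal ((cmod (l2_inner f (b i)))\<^sup>2)) = ennreal ((l2_norm f)\<^sup>2)"
proof -
  have fL: "f \<in> L2R" using f closed_span_L2R by blast
  \<comment> \<open>\<open>P n\<close> is the orthogonal projection of \<open>f\<close> onto the
    span of the first \<open>n\<close> vectors, hence its best approximation there;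
    \<open>pyth\<close> expresses this.\<close>
  define P where "P n = (\<Sum>i<n. fscale (l2_inner f (b i)) (b i))" for n
  have PL: "P n \<in> L2R" for n unfolding P_def by (intro L2R_sum L2R_fscale b)
  have Pin: "l2_inner (P n) (b j) = l2_inner f (b j)" if "j < n" for n j
    using that b by (simp add: P_def l2_inner_sum_left L2R_fscale l2_inner_fscale_left on
        if_distrib sum.delta cong: if_cong)
  have orth: "l2_inner g (f - P n) = 0 \<and> g \<in> L2R" if "g \<in> cfun.span (b ` {..<n})" for g n
    using that
  proof (induction rule: cfun.span_induct_alt)
    case (step c x y)
    then obtain j where j: "j < n" "x = b j" by auto
    have "l2_inner (f - P n) x = 0" using j Pin[of j n] by (simp add: l2_inner_diff_left fL PL b)
    then have "l2_inner x (f - P n) = 0" by (metis l2_inner_cnj complex_cnj_zero)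
    then show ?case using step j b fL PL
      by (simp add: l2_inner_add_left L2R_add L2R_fscale L2R_diff l2_inner_fscale_left)
  qed simp
  have Psp: "P n \<in> cfun.span (b ` {..<n})" for n
    unfolding P_def by (intro cfun.span_sum cfun.span_scale cfun.span_base) auto
  have pyth: "(l2_norm (f - g))\<^sup>2 = (l2_norm (f - P n))\<^sup>2 + (l2_norm (P n - g))\<^sup>2"
    if g: "g \<in> cfun.span (b ` {..<n})" for g n
  proof -
    have "l2_inner (P n - g) (f - P n) = 0"
      using orth[of "P n - g" n] g Psp cfun.span_diff by blast
    then have "l2_inner (f - P n) (P n - g) = 0" by (metis l2_inner_cnj complex_cnj_zero)
    then show ?thesis
      using l2_norm_add_sq[of "f - P n" "P n - g"] orth[OF g] fL PL by (simp add: L2R_diff)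
  qed
  have PP: "(l2_norm (P n))\<^sup>2 = (\<Sum>i<n. (cmod (l2_inner f (b i)))\<^sup>2)" for n
  proof -
    have "complex_of_real ((l2_norm (P n))\<^sup>2) = l2_inner (P n) (P n)" by (simp add: l2_inner_self)
    also have "\<dots> = (\<Sum>i<n. l2_inner f (b i) * l2_inner (b i) (P n))"
      using b PL by (subst (1) P_def) (simp add: l2_inner_sum_left L2R_fscale l2_inner_fscale_left)
    also have "\<dots> = (\<Sum>i<n. l2_inner f (b i) * cnj (l2_inner f (b i)))"
      by (intro sum.cong refl) (metis Pin l2_inner_cnj lessThan_iff)
    also have "\<dots> = of_real (\<Sum>i<n. (cmod (l2_inner f (b i)))\<^sup>2)"
      by (simp add: complex_norm_square del: of_real_power)
    finally show ?thesis by (simp only: of_real_eq_iff)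
  qed
  have bessel: "(\<Sum>i<n. (cmod (l2_inner f (b i)))\<^sup>2) = (l2_norm f)\<^sup>2 - (l2_norm (f - P n))\<^sup>2" for n
    using pyth[of 0 n] by (simp add: cfun.span_zero PP)
  \<comment> \<open>A finite combination involves finitely many vectors, so the increasing spans
    exhaust the algebraic span. This forces the remainder in \<open>bessel\<close> to 0.\<close>
  have fin: "\<exists>n. g \<in> cfun.span (b ` {..<n})" if "g \<in> cfun.span (range b)" for g
    using that
  proof (induction rule: cfun.span_induct_alt)
    case base then show ?case by (blast intro: cfun.span_zero)
  next
    case (step c x y)
    then obtain j n where jn: "x = b j" "y \<in> cfun.span (b ` {..<n})" by auto
    have "x \<in> cfun.span (b ` {..<max (Suc j) n})" using jn by (intro cfun.span_base) auto
    moreover have "y \<in> cfun.span (b ` {..<max (Suc j) n})"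
      using jn(2) cfun.span_mono[of "b ` {..<n}" "b ` {..<max (Suc j) n}"] by force
    ultimately show ?case by (blast intro: cfun.span_add cfun.span_scale)
  qed
  have "(\<lambda>i. (cmod (l2_inner f (b i)))\<^sup>2) sums (l2_norm f)\<^sup>2"
    unfolding sums_def bessel
  proof (rule LIMSEQ_I)
    fix r :: real assume r: "r > 0"
    then obtain g where g: "g \<in> cfun.span (range b)" "l2_norm (f - g) < sqrt r"
      using closed_spanD[OF f, of "sqrt r"] by auto
    then obtain m where m: "g \<in> cfun.span (b ` {..<m})" using fin by blast
    have "(l2_norm (f - P n))\<^sup>2 < r" if "n \<ge> m" for n
    proof -
      have "g \<in> cfun.span (b ` {..<n})"
        using m cfun.span_mono[of "b ` {..<m}" "b ` {..<n}"] that by force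
      from pyth[OF this] have "(l2_norm (f - P n))\<^sup>2 \<le> (l2_norm (f - g))\<^sup>2" by simp
      also have "\<dots> < (sqrt r)\<^sup>2" using g(2) by (intro power_strict_mono) auto
      finally show ?thesis using r by simp
    qed
    then show "\<exists>no. \<forall>n\<ge>no. norm ((l2_norm f)\<^sup>2 - (l2_norm (f - P n))\<^sup>2 - (l2_norm f)\<^sup>2) < r"
      by (intro exI[of _ m]) auto
  qed
  then show ?thesis
    by (simp add: suminf_ennreal2 sums_summable sums_unique[symmetric])
qed

text \<open>The line is cut into integer translates of one period and every piece is moved back.
  \<open>int_decode\<close> enumerates the integers, so that the sum is a series over the naturals,
  as in \<open>parseval\<close>.\<close>

lemma nn_integral_periodize:
  fixes h :: "real \<Rightarrow> ennreal"
  assumes [measurable]: "h \<in> borel_measurable borel"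
  shows "(\<integral>\<^sup>+x. h x \<partial>lborel)
    = (\<integral>\<^sup>+x. (\<Sum>i. h (x + of_int (int_decode i))) * indicator {-(1/2)<..1/2} x \<partial>lborel)"
proof -
  define J where "J m = {of_int m - 1/2<..of_int m + (1/2::real)}" for m :: int
  have disj: "disjoint_family (\<lambda>i. J (int_decode i))"
  proof (unfold disjoint_family_on_def, intro ballI impI)
    fix i j :: nat assume "i \<noteq> j"
    then have "int_decode i \<noteq> int_decode j" by (simp add: inj_int_decode[THEN inj_eq])
    then show "J (int_decode i) \<inter> J (int_decode j) = {}" unfolding J_def by auto
  qed
  have cov: "\<exists>i. x \<in> J (int_decode i)" for x
  proof -
    \<comment> \<open>The intervals are open on the left and closed on the right, so the right index
      is a ceiling rather than a floor.\<close>
    have "x \<in> J \<lceil>x - 1/2\<rceil>" unfolding J_def by simp linarith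
    then show ?thesis by (metis int_encode_inverse)
  qed
  have "(\<integral>\<^sup>+x. h x \<partial>lborel) = (\<integral>\<^sup>+x. (\<Sum>i. h x * indicator (J (int_decode i)) x) \<partial>lborel)"
    using cov suminf_cmult_indicator[OF disj, of _ _ "\<lambda>_. h _"]
    by (intro nn_integral_cong) metis
  also have "\<dots> = (\<Sum>i. \<integral>\<^sup>+x. h x * indicator (J (int_decode i)) x \<partial>lborel)"
    by (rule nn_integral_suminf) (simp add: J_def)
  also have "\<dots> = (\<Sum>i. \<integral>\<^sup>+x. h (x + of_int (int_decode i)) * indicator {-(1/2)<..1/2} x \<partial>lborel)"
  proof (rule suminf_cong)
    fix i
    show "(\<integral>\<^sup>+x. h x * indicator (J (int_decode i)) x \<partial>lborel)
      = (\<integral>\<^sup>+x. h (x + of_int (int_decode i)) * indicator {-(1/2)<..1/2} x \<partial>lborel)"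
      by (subst nn_integral_real_affine[of _ 1 "of_int (int_decode i)"])
        (auto simp: J_def indicator_def add.commute intro!: nn_integral_cong)
  qed
  also have "\<dots> = (\<integral>\<^sup>+x. (\<Sum>i. h (x + of_int (int_decode i)) * indicator {-(1/2)<..1/2} x) \<partial>lborel)"
    by (rule nn_integral_suminf[symmetric]) simp
  finally show ?thesis by simp
qed

section \<open>Completeness of the trigonometric system\<close>

lemma l2_norm_indicator_sq: "(l2_norm (indicator A))\<^sup>2 = measure lborel A"
proof -
  have "(\<lambda>x. (cmod (indicator A x))\<^sup>2) = (\<lambda>x. indicator A x :: real)"
    by (auto simp: indicator_def)
  then show ?thesis by (simp add: l2_norm_sq)
qed

definition character :: "real \<Rightarrow> real \<Rightarrow> complex" where
  "character a x = cis (2 * pi * (a * x))"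

lemma norm_character [simp]: "cmod (character a x) = 1"
  by (simp add: character_def)

lemma character_add: "character (a + b) x = character a x * character b x"
  by (simp add: character_def cis_mult algebra_simps)

lemma character_add_right: "character a (x + y) = character a x * character a y"
  by (simp add: character_def cis_mult algebra_simps)

lemma cnj_character [simp]: "cnj (character a x) = character (- a) x"
  by (simp add: character_def cis_cnj)

lemma character_commute: "character a x = character x a"
  by (simp add: character_def mult.commute)

lemma character_0 [simp]: "character 0 x = 1" "character a 0 = 1"
  by (simp_all add: character_def)

lemma character_int: "a * x = of_int k \<Longrightarrow> character a x = 1"
  by (metis character_def cis_multiple_2pi Ints_of_int)

lemma character_shift_int: "a * y = of_int k \<Longrightarrow> character a (x + y) = character a x"
  by (simp add: character_add_right character_int)

lemma character_eq_1D:
  assumes "character 1 x = 1" shows "\<exists>k. x = of_int k"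
proof -
  have "exp (\<i> * complex_of_real (2 * pi * x)) = 1"
    using assms by (simp add: character_def cis_conv_exp)
  then obtain n :: int where "2 * pi * x = of_int (2 * n) * pi" by (auto simp: exp_eq_1)
  then show ?thesis by (intro exI[of _ n]) simp
qed

lemma continuous_on_character [continuous_intros]: "continuous_on A (character a)"
  unfolding character_def by (intro continuous_intros)

lemma character_measurable [measurable]: "character a \<in> borel_measurable borel"
  by (intro borel_measurable_continuous_onI continuous_intros)

lemma L2R_character_mult: "f \<in> L2R \<Longrightarrow> (\<lambda>x. character a x * f x) \<in> L2R"
  by (rule L2R_mult_bounded[where C = 1]) auto

abbreviation unit_interval :: "real set" where "unit_interval \<equiv> {-(1/2)<..1/2}"

lemma integral_character_unit_interval:
  "(\<integral>x. indicator unit_interval x * character (of_int k) x \<partial>lborel) = (if k = 0 then 1 else 0)"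
proof (cases "k = 0")
  case True
  have "(\<integral>x. indicator unit_interval x * character (of_int k) x \<partial>lborel)
    = of_real (\<integral>x. indicator unit_interval x \<partial>lborel)"
    unfolding integral_complex_of_real[symmetric] using True
    by (intro Bochner_Integration.integral_cong) (auto simp: indicator_def)
  with True show ?thesis by simp
next
  case False
  define F where "F = (\<lambda>x. character (of_int k) x / (2 * pi * of_int k * \<i>))"
  have der: "(F has_vector_derivative character (of_int k) x) (at x within A)" for x A
  proof -
    let ?c = "2 * pi * of_int k * \<i>"
    have "((\<lambda>z. exp (?c * z) / ?c) has_field_derivative exp (?c * of_real x)) (at (of_real x))"
      using False by (auto intro!: derivative_eq_intros)
    from has_vector_derivative_real_field[OF this, of A] show ?thesis
      unfolding F_def character_def cis_conv_exp by (simp add: mult_ac)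
  qed
  have "(\<integral>x. indicator {-1/2..1/2} x *\<^sub>R character (of_int k) x \<partial>lborel) = F (1/2) - F (-1/2)"
    by (intro integral_FTC_atLeastAtMost der continuous_intros) auto
  also have "F (1/2) = F (-1/2)"
    using character_shift_int[of "of_int k" 1 k "-1/2"] by (simp add: F_def)
  also have "(\<integral>x. indicator {-1/2..1/2} x *\<^sub>R character (of_int k) x \<partial>lborel)
     = (\<integral>x. indicator unit_interval x * character (of_int k) x \<partial>lborel)"
  proof (rule integral_cong_AE)
    show "AE x in lborel. indicator {-1/2..1/2} x *\<^sub>R character (of_int k) x
        = indicator unit_interval x * character (of_int k) x"
      using AE_lborel_singleton[of "-1/2::real"] by eventually_elim (auto simp: indicator_def)
  qed (auto intro!: borel_measurable_continuous_onI continuous_intros)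
  finally show ?thesis using False by simp
qed

definition trig :: "int \<Rightarrow> real \<Rightarrow> complex" where
  "trig l = (\<lambda>x. indicator unit_interval x * character (of_int l) x)"

lemma L2R_trig [simp]: "trig l \<in> L2R"
  using L2R_character_mult[OF L2R_indicator_Ioc] by (simp add: trig_def mult.commute)

lemma trig_orthonormal: "l2_inner (trig l) (trig m) = (if l = m then 1 else 0)"
proof -
  have "l2_inner (trig l) (trig m)
    = (\<integral>x. indicator unit_interval x * character (of_int (l - m)) x \<partial>lborel)"
    unfolding l2_inner_def
    by (intro Bochner_Integration.integral_cong)
      (auto simp: trig_def indicator_def character_add[symmetric])
  then show ?thesis unfolding integral_character_unit_interval by simp
qed

text \<open>Characters on the whole line, generally outside \<open>L2R\<close>, so that products
  simply add frequencies. Restriction to a period is left to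
  \<open>trig_poly_restrict\<close>.\<close>

definition trig_poly :: "(real \<Rightarrow> complex) set" where
  "trig_poly = cfun.span (range (\<lambda>l::int. character (of_int l)))"

lemma trig_poly_char: "character (of_int l) \<in> trig_poly"
  unfolding trig_poly_def by (intro cfun.span_base) auto

lemma trig_poly_add: "f \<in> trig_poly \<Longrightarrow> g \<in> trig_poly \<Longrightarrow> f + g \<in> trig_poly"
  unfolding trig_poly_def by (rule cfun.span_add)

lemma trig_poly_scale: "f \<in> trig_poly \<Longrightarrow> fscale c f \<in> trig_poly"
  unfolding trig_poly_def by (rule cfun.span_scale)

lemma trig_poly_mult_char:
  assumes "f \<in> trig_poly" shows "f * character (of_int m) \<in> trig_poly"
  using assms unfolding trig_poly_def
proof (induction rule: cfun.span_induct_alt)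
  case base then show ?case by (simp add: cfun.span_zero)
next
  case (step c x y)
  then obtain l where l: "x = character (of_int l)" by auto
  have "(fscale c x + y) * character (of_int m)
      = fscale c (character (of_int (l + m))) + y * character (of_int m)"
    by (auto simp: l fun_eq_iff fscale_def plus_fun_apply times_fun_apply character_add algebra_simps)
  then show ?case
    using step trig_poly_char[of "l + m"]
    by (simp only: trig_poly_def cfun.span_add cfun.span_scale)
qed

lemma trig_poly_mult:
  assumes "f \<in> trig_poly" "g \<in> trig_poly" shows "f * g \<in> trig_poly"
  using assms(2) unfolding trig_poly_def
proof (induction rule: cfun.span_induct_alt)
  case base then show ?case by (simp add: cfun.span_zero)
next
  case (step c x y)
  then obtain l where l: "x = character (of_int l)" by auto
  have "f * (fscale c x + y) = fscale c (f * character (of_int l)) + f * y"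
    by (auto simp: l fun_eq_iff fscale_def plus_fun_apply times_fun_apply algebra_simps)
  then show ?case
    using step trig_poly_mult_char[OF assms(1), of l]
    by (simp only: trig_poly_def cfun.span_add cfun.span_scale)
qed

text \<open>A real-linear functional on the plane is a combination of \<open>z\<close> and
  \<open>cnj z\<close>, which on the circle are the frequencies 1 and -1. So the polynomials of the
  real Stone-Weierstrass theorem become trigonometric polynomials.\<close>

lemma trig_poly_real_polynomial:
  assumes "real_polynomial_function p"
  shows "(\<lambda>x. of_real (p (character 1 x))) \<in> trig_poly"
  using assms
proof induction
  case (linear f)
  interpret bounded_linear f by fact
  have "f z = Re z * f 1 + Im z * f \<i>" for z
  proof -
    have "z = Re z *\<^sub>R 1 + Im z *\<^sub>R \<i>" by (simp add: complex_eq_iff)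
    then show ?thesis using add[of "Re z *\<^sub>R 1" "Im z *\<^sub>R \<i>"] by (simp only: scaleR real_scaleR_def)
  qed
  moreover have "complex_of_real (Re z * u + Im z * v)
      = (of_real u - \<i> * of_real v) / 2 * z + (of_real u + \<i> * of_real v) / 2 * cnj z" for u v z
    by (simp add: complex_eq_iff field_simps)
  ultimately have *: "complex_of_real (f z)
      = (of_real (f 1) - \<i> * of_real (f \<i>)) / 2 * z + (of_real (f 1) + \<i> * of_real (f \<i>)) / 2 * cnj z" for z
    by metis
  have "(\<lambda>x. of_real (f (character 1 x)))
      = fscale ((of_real (f 1) - \<i> * of_real (f \<i>)) / 2) (character (of_int 1))
      + fscale ((of_real (f 1) + \<i> * of_real (f \<i>)) / 2) (character (of_int (-1)))"
    using *[of "character 1 _"] by (intro ext) (simp add: fscale_def plus_fun_apply del: of_real_eq_iff)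
  then show ?case by (simp only: trig_poly_add trig_poly_scale trig_poly_char)
next
  case (const c)
  have "(\<lambda>x. of_real c) = fscale (of_real c) (character (of_int 0))"
    by (auto simp: fun_eq_iff fscale_def)
  then show ?case by (metis trig_poly_scale trig_poly_char)
next
  case (add f g)
  from trig_poly_add[OF add.IH] show ?case by (simp add: plus_fun_def)
next
  case (mult f g)
  from trig_poly_mult[OF mult.IH] show ?case by (simp add: times_fun_def)
qed

lemma trig_poly_restrict:
  assumes "f \<in> trig_poly"
  shows "(\<lambda>x. indicator unit_interval x * f x) \<in> cfun.span (range trig)"
  using assms unfolding trig_poly_def
proof (induction rule: cfun.span_induct_alt)
  case base
  have "(\<lambda>x. indicator unit_interval x * 0 x) = (0 :: real \<Rightarrow> complex)"
    by (auto simp: fun_eq_iff zero_fun_apply)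
  then show ?case by (metis cfun.span_zero)
next
  case (step c x y)
  then obtain l where l: "x = character (of_int l)" by auto
  have "(\<lambda>x'. indicator unit_interval x' * (fscale c x + y) x')
      = fscale c (trig l) + (\<lambda>x. indicator unit_interval x * y x)"
    by (auto simp: l fun_eq_iff fscale_def plus_fun_apply trig_def algebra_simps)
  then show ?case
    using step by (auto intro!: cfun.span_add cfun.span_scale intro: cfun.span_base)
qed

text \<open>Uniform approximation on the circle is approximation in the seminorm on a period, which
  has length 1. Composition with \<open>character 1\<close> builds the periodicity in, so no
  condition at the endpoints arises.\<close>

lemma trig_closed_span_continuous:
  fixes f :: "complex \<Rightarrow> real"
  assumes f: "continuous_on UNIV f"
  shows "(\<lambda>x. indicator unit_interval x * of_real (f (character 1 x))) \<in> closed_span (range trig)"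
    (is "?g \<in> _")
proof -
  have restr: "(\<lambda>x. indicator unit_interval x * of_real (h (character 1 x))) \<in> L2R"
    if "continuous_on UNIV h" for h :: "complex \<Rightarrow> real"
  proof -
    have "compact (h ` sphere 0 1)"
      using that by (intro compact_continuous_image continuous_on_subset[OF that]) auto
    then obtain C where C: "\<And>z. z \<in> sphere 0 1 \<Longrightarrow> \<bar>h z\<bar> \<le> C"
      by (meson compact_imp_bounded bounded_real imageI)
    have hm: "h \<in> borel_measurable borel" by (rule borel_measurable_continuous_onI[OF that])
    have "(\<lambda>x. of_real (h (character 1 x)) * (indicator unit_interval x :: complex)) \<in> L2R"
    proof (rule L2R_mult_bounded[OF L2R_indicator_Ioc])
      show "(\<lambda>x. complex_of_real (h (character 1 x))) \<in> borel_measurable borel"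
        using hm by measurable
      show "cmod (complex_of_real (h (character 1 x))) \<le> C" for x
        using C[of "character 1 x"] by simp
    qed
    then show ?thesis by (simp add: mult.commute)
  qed
  have trigL: "range trig \<subseteq> L2R" by auto
  show ?thesis
  proof (rule closed_span_closed[OF trigL restr[OF f]])
    fix e :: real assume e: "e > 0"
    then obtain p where p: "real_polynomial_function p"
      "\<And>z. z \<in> sphere 0 1 \<Longrightarrow> \<bar>f z - p z\<bar> < e / 2"
      using Stone_Weierstrass_real_polynomial_function[of "sphere 0 1" f "e / 2"]
        continuous_on_subset[OF f] by (metis compact_sphere half_gt_zero subset_UNIV)
    let ?q = "\<lambda>x. indicator unit_interval x * of_real (p (character 1 x)) :: complex"
    have pc: "continuous_on UNIV p" using continuous_on_polymonial_function[of p UNIV] p(1) by (simp add: real_polynomial_function_eq)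
    have q: "?q \<in> closed_span (range trig)"
      by (rule closed_spanI_span[OF trig_poly_restrict[OF trig_poly_real_polynomial[OF p(1)]] restr[OF pc]])
    have "l2_norm (?g - ?q) \<le> l2_norm (fscale (of_real (e / 2)) (indicator unit_interval))"
    proof (rule l2_norm_le[OF L2R_fscale[OF L2R_indicator_Ioc]])
      show "?g - ?q \<in> borel_measurable borel"
        using L2R_diff[OF restr[OF f] restr[OF pc]] by (rule L2R_measurable)
      have "cmod (complex_of_real (f z) - complex_of_real (p z)) \<le> e / 2" if "cmod z = 1" for z
        using p(2)[of z] that by (simp flip: of_real_diff)
      then show "cmod ((?g - ?q) x) \<le> cmod (fscale (of_real (e / 2)) (indicator unit_interval) x)" for x
        using e by (auto simp: fscale_def indicator_def minus_apply)
    qed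
    also have "\<dots> = e / 2 * l2_norm (indicator unit_interval)" using e by (simp add: l2_norm_fscale)
    also have "l2_norm (indicator unit_interval) = 1"
      by (rule power2_eq_imp_eq) (simp_all add: l2_norm_indicator_sq)
    finally show "\<exists>g\<in>closed_span (range trig). l2_norm (?g - g) < e"
      using q e by (intro bexI[of _ ?q]) auto
  qed
qed

lemma trig_closed_span_Ioc:
  assumes "-1/2 \<le> x" "x < y" "y \<le> 1/2"
  shows "indicator {x<..y} \<in> closed_span (range trig)"
proof -
  define K where "K = character 1 ` {x..y}"
  have K: "compact K" "K \<noteq> {}"
    using assms unfolding K_def by (auto intro!: compact_continuous_image continuous_intros)
  \<comment> \<open>Continuous functions equal to 1 on the arc \<open>K\<close> and decreasing to
    its indicator, since \<open>K\<close> is closed.\<close>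
  define f where "f k z = max 0 (1 - real k * infdist z K)" for k z
  have fc: "continuous_on UNIV (f k)" for k unfolding f_def by (intro continuous_intros)
  define g :: "real \<Rightarrow> complex"
    where "g t = indicator unit_interval t * (if character 1 t \<in> K then 1 else 0)" for t
  have lim: "(\<lambda>k. f k z) \<longlonglongrightarrow> (if z \<in> K then 1 else 0)" for z
  proof (cases "z \<in> K")
    case True
    then show ?thesis by (simp add: f_def)
  next
    case False
    then have d: "infdist z K > 0"
      using K by (metis compact_imp_closed in_closed_iff_infdist_zero infdist_nonneg less_le)
    obtain n where n: "1 < real n * infdist z K"
      using d by (metis reals_Archimedean3)
    have "f k z = 0" if "k \<ge> n" for k
    proof -
      have "real n * infdist z K \<le> real k * infdist z K"
        using that d by (intro mult_right_mono) auto
      with n show ?thesis by (simp add: f_def)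
    qed
    then have "\<forall>\<^sub>F k in sequentially. f k z = 0" by (auto simp: eventually_sequentially)
    with False show ?thesis by (simp add: tendsto_eventually)
  qed
  have gm: "g \<in> borel_measurable borel"
  proof -
    have [measurable]: "K \<in> sets borel" using K by (simp add: compact_imp_closed)
    show ?thesis unfolding g_def by measurable
  qed
  have gspan: "g \<in> closed_span (range trig)"
  proof (rule closed_span_dominated[OF _ _ gm trig_closed_span_continuous[OF fc]])
    show "(\<lambda>k. indicator unit_interval t * complex_of_real (f k (character 1 t))) \<longlonglongrightarrow> g t" for t
    proof -
      have "(\<lambda>k. indicator unit_interval t * complex_of_real (f k (character 1 t)))
        \<longlonglongrightarrow> indicator unit_interval t * complex_of_real (if character 1 t \<in> K then 1 else 0)"
        by (intro tendsto_intros lim)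
      moreover have "indicator unit_interval t * complex_of_real (if character 1 t \<in> K then 1 else 0) = g t"
        by (simp add: g_def)
      ultimately show ?thesis by metis
    qed
    show "cmod (indicator unit_interval t * complex_of_real (f k (character 1 t)))
        \<le> cmod (indicator unit_interval t)" for k t
      by (auto simp: f_def indicator_def infdist_nonneg)
  qed (auto intro: L2R_indicator_Ioc)
  \<comment> \<open>Two exceptional points: the closed arc contains the image of \<open>x\<close>,
    which the half-open interval omits, and if \<open>x\<close> is -1/2 the point 1/2 has the same
    image.\<close>
  have gae: "AE t in lborel. g t = indicator {x<..y} t"
    using AE_lborel_singleton[of x] AE_lborel_singleton[of "1/2 :: real"]
  proof eventually_elim
    case (elim t)
    have "t \<in> {x<..y}" if t: "t \<in> unit_interval" "character 1 t \<in> K"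
    proof -
      obtain u where u: "u \<in> {x..y}" "character 1 t = character 1 u" using t(2) by (auto simp: K_def)
      have "character 1 (t - u) = 1"
        using u(2) character_add_right[of 1 t "- u"] character_add_right[of 1 u "- u"] by simp
      then obtain k where k: "t - u = of_int k" using character_eq_1D by blast
      have "\<bar>t - u\<bar> < 1" using t(1) u(1) assms elim by auto
      then have "k = 0" using k by linarith
      with k u t elim show ?thesis by auto
    qed
    moreover have "character 1 t \<in> K" if "t \<in> {x<..y}" using that by (auto simp: K_def)
    ultimately show ?case using assms by (auto simp: g_def indicator_def)
  qed
  show ?thesis
    by (rule closed_span_AE[OF _ gspan _ gae]) auto
qed

lemma trig_closed_span:
  assumes f: "f \<in> L2R"
  shows "(\<lambda>x. indicator unit_interval x * f x) \<in> closed_span (range trig)"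
proof -
  \<comment> \<open>Functions that vanish on the period are added so that the criterion for density
    on the whole line applies; the contraction \<open>?\<Phi>\<close>, restriction to the period,
    then sends them to 0.\<close>
  define S where "S = range trig \<union> {f \<in> L2R. \<forall>x\<in>unit_interval. f x = 0}"
  have S: "S \<subseteq> L2R" by (auto simp: S_def)
  have "indicator {x<..y} \<in> closed_span S" for x y :: real
  proof -
    have 1: "indicator ({x<..y} \<inter> unit_interval) \<in> closed_span S"
    proof (cases "max x (-1/2) < min y (1/2)")
      case True
      have "{x<..y} \<inter> unit_interval = {max x (-1/2)<..min y (1/2)}" by auto
      moreover have "indicator {max x (-1/2)<..min y (1/2)} \<in> closed_span (range trig)"
        using True by (intro trig_closed_span_Ioc) auto
      moreover have "closed_span (range trig) \<subseteq> closed_span S"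
        by (rule closed_span_mono_closed[OF _ S]) (auto simp: S_def intro!: closed_span_base)
      ultimately show ?thesis by auto
    next
      case False
      then have "(indicator ({x<..y} \<inter> unit_interval) :: real \<Rightarrow> complex) = 0"
        by (auto simp: fun_eq_iff zero_fun_apply indicator_def)
      then show ?thesis using cfun.subspace_0[OF subspace_closed_span[OF S]] by simp
    qed
    have "(\<lambda>t. indicator (- unit_interval) t * indicator {x<..y} t) \<in> L2R"
      by (rule L2R_mult_bounded[where C = 1, OF L2R_indicator_Ioc]) (auto simp: indicator_def)
    then have 2: "(\<lambda>t. indicator (- unit_interval) t * indicator {x<..y} t) \<in> closed_span S"
      by (intro closed_span_base) (auto simp: S_def)
    have "indicator {x<..y} = (indicator ({x<..y} \<inter> unit_interval)
        + (\<lambda>t. indicator (- unit_interval) t * indicator {x<..y} t) :: real \<Rightarrow> complex)"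
      by (auto simp: fun_eq_iff plus_fun_apply indicator_def)
    then show ?thesis using closed_span_add[OF S 1 2] by simp
  qed
  then have "f \<in> closed_span S" using f closed_span_eq_L2R[OF S] by simp
  let ?\<Phi> = "\<lambda>f x. indicator unit_interval x * f x :: complex"
  have bnd: "?\<Phi> g \<in> L2R" if "g \<in> L2R" for g
    by (rule L2R_mult_bounded[where C = 1, OF that]) (auto simp: indicator_def)
  have "?\<Phi> f \<in> closed_span (?\<Phi> ` S)"
  proof (rule closed_span_image_L2R[OF S f \<open>f \<in> closed_span S\<close>])
    show "l2_norm (?\<Phi> g) \<le> l2_norm g" if "g \<in> L2R" for g
      by (rule l2_norm_le[OF that L2R_measurable[OF bnd[OF that]]]) (auto simp: indicator_def)
    show "?\<Phi> g \<in> L2R" if "g \<in> L2R" for g by (rule bnd[OF that])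
  qed (auto simp: fun_eq_iff plus_fun_apply fscale_def algebra_simps)
  moreover have "closed_span (?\<Phi> ` S) \<subseteq> closed_span (range trig)"
  proof (rule closed_span_mono_closed)
    show "?\<Phi> ` S \<subseteq> closed_span (range trig)"
    proof (intro image_subsetI)
      fix g assume "g \<in> S"
      then consider l where "g = trig l" | "\<forall>x\<in>unit_interval. g x = 0" by (auto simp: S_def)
      then show "?\<Phi> g \<in> closed_span (range trig)"
      proof cases
        case (1 l)
        then have "?\<Phi> g = trig l" by (auto simp: trig_def fun_eq_iff indicator_def)
        then show ?thesis by (auto intro!: closed_span_base)
      next
        case 2
        then have "?\<Phi> g = 0" by (auto simp: zero_fun_apply fun_eq_iff indicator_def)
        then show ?thesis by (simp add: closed_spanI_span cfun.span_zero)
      qed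
    qed
  qed auto
  ultimately show ?thesis by blast
qed

section \<open>The inverse Fourier transform on functions of bounded support\<close>

definition bounded_support :: "(real \<Rightarrow> complex) set" where
  "bounded_support = {g \<in> L2R. \<exists>R. \<forall>x. R < \<bar>x\<bar> \<longrightarrow> g x = 0}"

lemma bounded_support_L2R: "bounded_support \<subseteq> L2R"
  by (auto simp: bounded_support_def)

lemma bounded_supportI: "g \<in> L2R \<Longrightarrow> (\<And>x. R < \<bar>x\<bar> \<Longrightarrow> g x = 0) \<Longrightarrow> g \<in> bounded_support"
  by (auto simp: bounded_support_def)

lemma subspace_bounded_support: "cfun.subspace bounded_support"
  unfolding cfun.subspace_def
proof (intro conjI ballI allI)
  show "0 \<in> bounded_support" by (rule bounded_supportI) (auto simp: zero_fun_apply)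
next
  fix f g assume fg: "f \<in> bounded_support" "g \<in> bounded_support"
  then obtain R R' where "\<And>x. R < \<bar>x\<bar> \<Longrightarrow> f x = 0" "\<And>x. R' < \<bar>x\<bar> \<Longrightarrow> g x = 0"
    by (auto simp: bounded_support_def)
  then show "f + g \<in> bounded_support"
    using fg by (intro bounded_supportI[of _ "max R R'"])
      (auto simp: bounded_support_def plus_fun_apply intro!: L2R_add)
next
  fix c f assume "f \<in> bounded_support"
  then show "fscale c f \<in> bounded_support"
    by (auto simp: bounded_support_def fscale_def[of c f] intro!: L2R_fscale[of f c, unfolded fscale_def])
qed

text \<open>The function equals its product with the indicator of a bounded interval, and a product
  of two elements of \<open>L2R\<close> is integrable.\<close>

lemma bounded_support_integrable:
  assumes "g \<in> bounded_support" shows "integrable lborel g"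
proof -
  obtain R where R: "\<And>x. R < \<bar>x\<bar> \<Longrightarrow> g x = 0" and g: "g \<in> L2R"
    using assms by (auto simp: bounded_support_def)
  have "(indicator {-R..R} :: real \<Rightarrow> complex) \<in> L2R"
    by (cases "-R \<le> R") (auto intro!: L2R_indicator)
  then have "integrable lborel (\<lambda>x. g x * cnj (indicator {-R..R} x))"
    using g by (rule L2R_inner_integrable[rotated])
  moreover have "g x * cnj (indicator {-R..R} x) = g x" for x
    using R[of x] by (cases "R < \<bar>x\<bar>") (auto simp: indicator_def)
  ultimately show ?thesis by simp
qed

lemma bounded_support_character_mult:
  "g \<in> bounded_support \<Longrightarrow> (\<lambda>x. character a x * g x) \<in> bounded_support"
  by (auto simp: bounded_support_def L2R_character_mult)

lemma bounded_support_indicator_Ioc: "(indicator {a<..b} :: real \<Rightarrow> complex) \<in> bounded_support"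
  by (rule bounded_supportI[of _ "max \<bar>a\<bar> \<bar>b\<bar>"]) (auto simp: L2R_indicator_Ioc indicator_def)

text \<open>The wavelet is prescribed on the frequency side by a function of bounded support, so only the
  inverse transform is needed, and only where the integral converges absolutely.\<close>

definition fourier :: "(real \<Rightarrow> complex) \<Rightarrow> real \<Rightarrow> complex" where
  "fourier g = (\<lambda>t. \<integral>x. g x * character t x \<partial>lborel)"

lemma integrable_mult_character:
  assumes "integrable lborel g" shows "integrable lborel (\<lambda>x. g x * character t x)"
  by (rule Bochner_Integration.integrable_bound[OF assms])
    (use assms in \<open>auto simp: norm_mult\<close>)

lemma fourier_add:
  "f \<in> bounded_support \<Longrightarrow> g \<in> bounded_support \<Longrightarrow> fourier (f + g) = fourier f + fourier g"
  unfolding fourier_def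
  by (simp add: fun_eq_iff plus_fun_apply distrib_right integrable_mult_character bounded_support_integrable)

lemma fourier_fscale: "fourier (fscale c g) = fscale c (fourier g)"
  by (simp add: fourier_def fscale_def mult.assoc)

lemma fourier_measurable:
  assumes [measurable]: "g \<in> borel_measurable borel"
  shows "fourier g \<in> borel_measurable borel"
  unfolding fourier_def character_def
  by (rule lborel.borel_measurable_lebesgue_integral) (measurable; simp add: cis_conv_exp)

lemma translation_fourier: "translation a (fourier g) = fourier (\<lambda>x. character (- a) x * g x)"
proof
  fix t
  have "character (t - a) x = character t x * character (- a) x" for x
    using character_add[of t "- a" x] by simp
  then show "translation a (fourier g) t = fourier (\<lambda>x. character (- a) x * g x) t"
    by (simp add: translation_def fourier_def mult_ac)
qed

lemma fourier_scale:
  assumes "\<delta> > 0" shows "fourier g (\<delta> * t) = fourier (\<lambda>x. g (x / \<delta>) / of_real \<delta>) t"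
proof -
  have "fourier (\<lambda>x. g (x / \<delta>) / of_real \<delta>) t
      = \<bar>\<delta>\<bar> *\<^sub>R (\<integral>x. g ((0 + \<delta> * x) / \<delta>) / of_real \<delta> * character t (0 + \<delta> * x) \<partial>lborel)"
    unfolding fourier_def using assms by (intro lborel_integral_real_affine) simp
  also have "(\<lambda>x. g ((0 + \<delta> * x) / \<delta>) / of_real \<delta> * character t (0 + \<delta> * x))
      = (\<lambda>x. (1 / of_real \<delta>) * (g x * character (\<delta> * t) x))"
    using assms by (auto simp: fun_eq_iff character_def mult_ac)
  finally show ?thesis using assms by (simp add: fourier_def scaleR_conv_of_real)
qed

section \<open>Plancherel's identity and density of the range\<close>

lemma fourier_nn_norm_unit_interval:
  assumes g: "g \<in> L2R" and supp: "\<And>x. x \<notin> unit_interval \<Longrightarrow> g x = 0"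
  shows "(\<integral>\<^sup>+t. ennreal ((cmod (fourier g t))\<^sup>2) \<partial>lborel) = (\<integral>\<^sup>+x. ennreal ((cmod (g x))\<^sup>2) \<partial>lborel)"
proof -
  have [measurable]: "fourier g \<in> borel_measurable borel" using g by (intro fourier_measurable) (simp add: L2R_def)
  \<comment> \<open>The sign makes the conjugation in \<open>l2_inner\<close> produce frequency
    \<open>+ int_decode i\<close>, the offset at which \<open>fourier g\<close> is sampled.\<close>
  define b where "b i = trig (- int_decode i)" for i
  have rb: "range b = range trig"
  proof -
    have "trig l \<in> range b" for l
      by (rule range_eqI[of _ _ "int_encode (- l)"]) (simp add: b_def)
    then show ?thesis by (auto simp: b_def)
  qed
  have bon: "l2_inner (b i) (b j) = (if i = j then 1 else 0)" for i j
    by (simp add: b_def trig_orthonormal inj_int_decode[THEN inj_eq])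
  \<comment> \<open>The values of \<open>fourier g\<close> on \<open>t\<close> plus the integers are
    the Fourier coefficients of \<open>character t\<close> times \<open>g\<close>. By Parseval their
    square sum does not depend on \<open>t\<close>, so integrating over one period gives the norm on
    the line.\<close>
  have inner: "(\<Sum>i. ennreal ((cmod (fourier g (t + of_int (int_decode i))))\<^sup>2)) = ennreal ((l2_norm g)\<^sup>2)" for t
  proof -
    let ?h = "\<lambda>x. character t x * g x"
    have h: "?h \<in> L2R" using g by (rule L2R_character_mult)
    have "(\<lambda>x. indicator unit_interval x * ?h x) = ?h"
      using supp by (auto simp: fun_eq_iff indicator_def)
    then have hc: "?h \<in> closed_span (range b)" using trig_closed_span[OF h] rb by simp
    have inn: "l2_inner ?h (b i) = fourier g (t + of_int (int_decode i))" for i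
      unfolding l2_inner_def fourier_def
      by (intro Bochner_Integration.integral_cong)
        (use supp in \<open>auto simp: b_def trig_def indicator_def character_add\<close>)
    have nrm: "l2_norm ?h = l2_norm g" by (simp add: l2_norm_def norm_mult)
    have bL: "b i \<in> L2R" for i by (simp add: b_def)
    show ?thesis using parseval[OF bL bon hc] unfolding inn nrm .
  qed
  have "(\<integral>\<^sup>+t. ennreal ((cmod (fourier g t))\<^sup>2) \<partial>lborel)
    = (\<integral>\<^sup>+t. ennreal ((l2_norm g)\<^sup>2) * indicator unit_interval t \<partial>lborel)"
    by (subst nn_integral_periodize) (measurable, simp only: inner)
  also have "\<dots> = ennreal ((l2_norm g)\<^sup>2)" by (simp add: nn_integral_cmult_indicator)
  finally show ?thesis using l2_norm_sq_nn[OF g] by simp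
qed

lemma L2R_rescale:
  assumes f: "f \<in> L2R" and "c \<noteq> 0" shows "(\<lambda>x. f (c * x)) \<in> L2R"
proof -
  have "integrable lborel (\<lambda>x. (cmod (f (0 + c * x)))\<^sup>2)"
    by (rule lborel_integrable_real_affine[OF L2R_sq_integrable[OF f] assms(2)])
  then show ?thesis using L2R_measurable[OF f] by (simp add: L2R_def)
qed

lemma fourier_nn_norm:
  assumes g: "g \<in> bounded_support"
  shows "(\<integral>\<^sup>+t. ennreal ((cmod (fourier g t))\<^sup>2) \<partial>lborel) = (\<integral>\<^sup>+x. ennreal ((cmod (g x))\<^sup>2) \<partial>lborel)"
proof -
  obtain R0 where R0: "\<And>x. R0 < \<bar>x\<bar> \<Longrightarrow> g x = 0" and gL: "g \<in> L2R"
    using g by (auto simp: bounded_support_def)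
  define R where "R = max R0 1"
  have R: "g x = 0" if "R < \<bar>x\<bar>" for x using R0 that by (simp add: R_def)
  have [measurable]: "g \<in> borel_measurable borel" "fourier g \<in> borel_measurable borel"
    using gL by (auto simp: L2R_def intro!: fourier_measurable)
  \<comment> \<open>Rescaling by \<open>\<delta>\<close> moves the support from
    \<open>[-R, R]\<close> to \<open>[-1/4, 1/4]\<close>, inside one period.\<close>
  define \<delta> where "\<delta> = 1 / (4 * R)"
  have \<delta>: "\<delta> > 0" "1 / \<delta> > 0" by (auto simp: \<delta>_def R_def)
  define h where "h x = g (x / \<delta>) / of_real \<delta>" for x
  have hL: "h \<in> L2R"
    using L2R_fscale[OF L2R_rescale[OF gL, of "1 / \<delta>"], of "1 / of_real \<delta>"] \<delta>
    by (simp add: h_def[abs_def] fscale_def)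
  have hs: "h x = 0" if "x \<notin> unit_interval" for x
  proof -
    have "\<bar>x\<bar> \<ge> 1/2" using that by auto
    moreover have "R \<ge> 1" by (simp add: R_def)
    ultimately have "1/2 * (4 * R) \<le> \<bar>x\<bar> * (4 * R)" by (intro mult_right_mono) auto
    then have "R < \<bar>x / \<delta>\<bar>" using \<open>R \<ge> 1\<close> by (simp add: \<delta>_def abs_mult)
    then show ?thesis using R[of "x / \<delta>"] by (simp add: h_def)
  qed
  have "ennreal \<delta> * (\<integral>\<^sup>+t. ennreal ((cmod (fourier g (0 + \<delta> * t)))\<^sup>2) \<partial>lborel)
      = (\<integral>\<^sup>+t. ennreal ((cmod (fourier g t))\<^sup>2) \<partial>lborel)"
    using \<delta> by (subst nn_integral_real_affine[of _ \<delta> 0]) auto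
  moreover have "(\<integral>\<^sup>+t. ennreal ((cmod (fourier g (0 + \<delta> * t)))\<^sup>2) \<partial>lborel)
      = (\<integral>\<^sup>+x. ennreal ((cmod (h x))\<^sup>2) \<partial>lborel)"
    using fourier_nn_norm_unit_interval[OF hL hs] fourier_scale[OF \<delta>(1), of g]
    by (simp add: h_def[abs_def])
  moreover have "(\<integral>\<^sup>+x. ennreal ((cmod (h x))\<^sup>2) \<partial>lborel)
      = ennreal \<delta> * (\<integral>\<^sup>+x. ennreal ((cmod (h (0 + \<delta> * x)))\<^sup>2) \<partial>lborel)"
    using \<delta> hL by (subst nn_integral_real_affine[of _ \<delta> 0]) (auto simp: L2R_def)
  moreover have "(\<integral>\<^sup>+x. ennreal ((cmod (h (0 + \<delta> * x)))\<^sup>2) \<partial>lborel)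
      = (\<integral>\<^sup>+x. ennreal (1 / \<delta>\<^sup>2) * ennreal ((cmod (g x))\<^sup>2) \<partial>lborel)"
    using \<delta> by (intro nn_integral_cong)
      (simp add: h_def norm_divide power_divide flip: ennreal_mult')
  moreover have "\<dots> = ennreal (1 / \<delta>\<^sup>2) * (\<integral>\<^sup>+x. ennreal ((cmod (g x))\<^sup>2) \<partial>lborel)"
    by (rule nn_integral_cmult) simp
  moreover have "ennreal \<delta> * (ennreal \<delta> * (ennreal (1 / \<delta>\<^sup>2) * I)) = I" for I
    using \<delta> by (simp add: power2_eq_square mult.assoc[symmetric] flip: ennreal_mult')
  ultimately show ?thesis by metis
qed

lemma fourier_L2R: "g \<in> bounded_support \<Longrightarrow> fourier g \<in> L2R"
  using fourier_nn_norm[of g] bounded_support_L2R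
  by (auto simp: L2R_iff_nn intro!: fourier_measurable)

lemma l2_norm_fourier: "g \<in> bounded_support \<Longrightarrow> l2_norm (fourier g) = l2_norm g"
  using fourier_nn_norm[of g] fourier_L2R[of g] bounded_support_L2R by (intro l2_norm_eqI) auto

lemma l2_inner_fourier:
  "f \<in> bounded_support \<Longrightarrow> g \<in> bounded_support \<Longrightarrow> l2_inner (fourier f) (fourier g) = l2_inner f g"
  by (rule l2_inner_isometry[OF subspace_bounded_support bounded_support_L2R])
    (auto simp: fourier_add fourier_fscale fourier_L2R l2_norm_fourier)

lemma fourier_closed_span:
  assumes "S \<subseteq> bounded_support" "g \<in> bounded_support" "g \<in> closed_span S"
  shows "fourier g \<in> closed_span (fourier ` S)"
  by (rule closed_span_image[OF subspace_bounded_support bounded_support_L2R assms])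
    (auto simp: fourier_add fourier_fscale fourier_L2R l2_norm_fourier)

text \<open>Fubini for the kernel \<open>K\<close>. As \<open>fourier\<close> has the sign of the
  inverse transform, \<open>fourier f (- x)\<close> is the forward transform of \<open>f\<close>,
  that is, the adjoint applied to \<open>f\<close>.\<close>

lemma fourier_duality:
  assumes f: "integrable lborel f" and g: "integrable lborel g"
  shows "l2_inner (fourier g) f = l2_inner g (\<lambda>x. fourier f (- x))"
proof -
  have [measurable]: "f \<in> borel_measurable borel" "g \<in> borel_measurable borel"
    using f g by auto
  define K where "K t x = (g x * cnj (f t)) * character t x" for t x
  have Km: "case_prod K \<in> borel_measurable (lborel \<Otimes>\<^sub>M lborel)"
  proof -
    have "(\<lambda>t. cnj (f t)) \<in> borel_measurable borel"
      by (rule borel_measurable_continuous_on[where f = cnj]) (auto intro: continuous_intros)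
    note [measurable] = this
    have "(\<lambda>p. character (fst p) (snd p)) \<in> borel_measurable (borel :: (real \<times> real) measure)"
      unfolding character_def by (intro borel_measurable_continuous_onI continuous_intros)
    then have [measurable]: "(\<lambda>p. character (fst p) (snd p)) \<in> borel_measurable (borel \<Otimes>\<^sub>M borel)"
      by (simp add: borel_prod)
    show ?thesis unfolding K_def case_prod_unfold by measurable
  qed
  have int: "integrable (lborel \<Otimes>\<^sub>M lborel) (case_prod K)"
  proof (rule lborel_pair.Fubini_integrable[OF Km])
    have "integrable lborel (\<lambda>t. cmod (f t) * (\<integral>x. cmod (g x) \<partial>lborel))"
      using f by simp
    then show "integrable lborel (\<lambda>x. \<integral>y. norm (case (x, y) of (t, x) \<Rightarrow> K t x) \<partial>lborel)"
      by (simp add: K_def norm_mult mult.commute)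
    show "AE x in lborel. integrable lborel (\<lambda>y. case (x, y) of (t, x) \<Rightarrow> K t x)"
    proof (rule AE_I2)
      fix t
      have "integrable lborel (\<lambda>x. cnj (f t) * (g x * character t x))"
        using integrable_mult_character[OF g] by simp
      then show "integrable lborel (\<lambda>y. case (t, y) of (t, x) \<Rightarrow> K t x)"
        by (simp add: K_def mult_ac)
    qed
  qed
  have "l2_inner (fourier g) f = (\<integral>t. (\<integral>x. K t x \<partial>lborel) \<partial>lborel)"
    unfolding l2_inner_def
  proof (intro Bochner_Integration.integral_cong refl)
    fix t
    have "(\<integral>x. K t x \<partial>lborel) = (\<integral>x. g x * character t x * cnj (f t) \<partial>lborel)"
      unfolding K_def by (simp add: mult_ac)
    also have "\<dots> = fourier g t * cnj (f t)"
      unfolding fourier_def by (rule integral_mult_left_zero)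
    finally show "fourier g t * cnj (f t) = (\<integral>x. K t x \<partial>lborel)" by simp
  qed
  also have "\<dots> = (\<integral>x. (\<integral>t. K t x \<partial>lborel) \<partial>lborel)"
    using lborel_pair.Fubini_integral[OF int] by simp
  also have "\<dots> = l2_inner g (\<lambda>x. fourier f (- x))"
    unfolding l2_inner_def
  proof (intro Bochner_Integration.integral_cong refl)
    fix x
    have "(\<integral>t. K t x \<partial>lborel) = (\<integral>t. g x * cnj (f t * character (- x) t) \<partial>lborel)"
      unfolding K_def by (simp add: character_commute[of x] mult.assoc)
    also have "\<dots> = g x * (\<integral>t. cnj (f t * character (- x) t) \<partial>lborel)"
      by (rule integral_mult_right_zero)
    also have "(\<integral>t. cnj (f t * character (- x) t) \<partial>lborel) = cnj (fourier f (- x))"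
      unfolding fourier_def by (rule Bochner_Integration.integral_cnj)
    finally show "(\<integral>t. K t x \<partial>lborel) = g x * cnj (fourier f (- x))" .
  qed
  finally show ?thesis .
qed

text \<open>Let \<open>v\<close> be the forward transform of an indicator \<open>f\<close>, and
  \<open>g k\<close> its truncations. Duality turns the inner product of \<open>f\<close> with
  \<open>fourier (g k)\<close> into the one of \<open>v\<close> with \<open>g k\<close>, so by the
  isometry both errors have the same seminorm, and \<open>v - g k\<close> tends to 0.\<close>

lemma closed_span_fourier_range: "closed_span (fourier ` bounded_support) = L2R"
proof (rule closed_span_eq_L2R)
  show sub: "fourier ` bounded_support \<subseteq> L2R" by (auto simp: fourier_L2R)
  fix a b :: real assume "a < b"
  define f :: "real \<Rightarrow> complex" where "f = indicator {a<..b}"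
  have f: "f \<in> bounded_support" "f \<in> L2R"
    by (simp_all add: f_def bounded_support_indicator_Ioc L2R_indicator_Ioc)
  define v where "v x = fourier f (- x)" for x
  have v: "v \<in> L2R" using L2R_rescale[OF fourier_L2R[OF f(1)], of "-1"] by (simp add: v_def[abs_def])
  have nv: "l2_norm v = l2_norm f"
  proof -
    have "(\<integral>x. (cmod (fourier f x))\<^sup>2 \<partial>lborel) = (\<integral>x. (cmod (v x))\<^sup>2 \<partial>lborel)"
      by (subst lborel_integral_real_affine[of "-1" _ 0]) (simp_all add: v_def)
    then show ?thesis using l2_norm_fourier[OF f(1)] by (simp add: l2_norm_def)
  qed
  define g where "g k x = indicator {- real k<..real k} x * v x" for k x
  have gL: "g k \<in> L2R" for k
    unfolding g_def[abs_def] by (rule L2R_mult_bounded[where C = 1, OF v]) (auto simp: indicator_def)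
  have g: "g k \<in> bounded_support" for k
    by (rule bounded_supportI[OF gL, of "real k"]) (auto simp: g_def indicator_def)
  have eq: "l2_norm (f - fourier (g k)) = l2_norm (v - g k)" for k
  proof -
    have gv: "l2_inner (g k) v = of_real ((l2_norm (g k))\<^sup>2)"
      unfolding l2_inner_self[symmetric] l2_inner_def
      by (intro Bochner_Integration.integral_cong) (auto simp: g_def indicator_def)
    have gf: "l2_inner (fourier (g k)) f = l2_inner (g k) v"
      using fourier_duality[OF bounded_support_integrable[OF f(1)] bounded_support_integrable[OF g]]
      by (simp add: v_def[abs_def])
    have "Re (l2_inner f (fourier (g k))) = (l2_norm (g k))\<^sup>2"
      using gf gv by (metis l2_inner_cnj Re_complex_of_real complex_cnj_complex_of_real)
    moreover have "Re (l2_inner v (g k)) = (l2_norm (g k))\<^sup>2"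
      using gv by (metis l2_inner_cnj Re_complex_of_real complex_cnj_complex_of_real)
    ultimately have "(l2_norm (f - fourier (g k)))\<^sup>2 = (l2_norm (v - g k))\<^sup>2"
      using l2_norm_diff_sq[OF f(2) fourier_L2R[OF g]] l2_norm_diff_sq[OF v gL]
      by (simp add: nv l2_norm_fourier[OF g])
    then show ?thesis by (simp add: power2_eq_iff_nonneg)
  qed
  have "(\<lambda>k. l2_norm (v - g k)) \<longlonglongrightarrow> 0"
  proof (rule L2R_dominated(2)[OF v])
    show "(\<lambda>k. g k x) \<longlonglongrightarrow> v x" for x
    proof -
      obtain n where n: "\<bar>x\<bar> < real n" using reals_Archimedean2 by blast
      then have "\<forall>\<^sub>F k in sequentially. g k x = v x"
        by (intro eventually_sequentiallyI[of n]) (auto simp: g_def indicator_def)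
      then show ?thesis by (rule tendsto_eventually)
    qed
    show "cmod (g k x) \<le> cmod (v x)" for k x by (auto simp: g_def indicator_def)
  qed (use v gL L2R_measurable in auto)
  then have "(\<lambda>k. l2_norm (f - fourier (g k))) \<longlonglongrightarrow> 0" by (simp add: eq)
  then show "indicator {a<..b} \<in> closed_span (fourier ` bounded_support)"
    unfolding f_def[symmetric]
    by (intro closed_span_limit[OF sub f(2), of "\<lambda>k. fourier (g k)"])
      (auto intro!: closed_span_base fourier_L2R g)
qed

lemma fourier_complete:
  assumes "S \<subseteq> bounded_support" "closed_span S = L2R"
  shows "closed_span (fourier ` S) = L2R"
proof (rule antisym[OF closed_span_L2R])
  have "fourier ` bounded_support \<subseteq> closed_span (fourier ` S)"
    using assms bounded_support_L2R by (auto intro!: fourier_closed_span)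
  moreover have "fourier ` S \<subseteq> L2R" using assms(1) fourier_L2R by auto
  ultimately have "closed_span (fourier ` bounded_support) \<subseteq> closed_span (fourier ` S)"
    by (intro closed_span_mono_closed)
  then show "L2R \<subseteq> closed_span (fourier ` S)" by (simp add: closed_span_fourier_range)
qed

section \<open>The wavelet on the frequency side\<close>

text \<open>The conjugate of the \<open>j\<close>-th power of the dilation under the Fourier
  integral, see \<open>dilation_fourier\<close>. Compression in time spreads frequencies, whence the
  exponents \<open>- j\<close>.\<close>

definition fdilation :: "int \<Rightarrow> (real \<Rightarrow> complex) \<Rightarrow> real \<Rightarrow> complex" where
  "fdilation j f = (\<lambda>x. complex_of_real (sqrt 2) powi (- j) * f (2 powi (- j) * x))"

lemma fdilation_0 [simp]: "fdilation 0 f = f"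
  by (simp add: fdilation_def)

lemma fdilation_fdilation: "fdilation j (fdilation k f) = fdilation (j + k) f"
proof
  fix x
  have "complex_of_real (sqrt 2) powi (- (j + k))
      = complex_of_real (sqrt 2) powi (- j) * complex_of_real (sqrt 2) powi (- k)"
    using power_int_add[of "complex_of_real (sqrt 2)" "- j" "- k"] by (simp add: algebra_simps)
  moreover have "(2::real) powi (- (j + k)) = 2 powi (- k) * 2 powi (- j)"
    using power_int_add[of "2::real" "- k" "- j"] by (simp add: algebra_simps)
  ultimately show "fdilation j (fdilation k f) x = fdilation (j + k) f x"
    unfolding fdilation_def by (simp only: mult.assoc)
qed

lemma fdilation_add: "fdilation j (f + g) = fdilation j f + fdilation j g"
  by (simp add: fdilation_def fun_eq_iff plus_fun_apply distrib_left)

lemma fdilation_fscale: "fdilation j (fscale c f) = fscale c (fdilation j f)"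
  by (simp add: fdilation_def fun_eq_iff fscale_def)

lemma L2R_fdilation: "f \<in> L2R \<Longrightarrow> fdilation j f \<in> L2R"
  using L2R_fscale[OF L2R_rescale, of f "2 powi (- j)"] by (simp add: fdilation_def fscale_def)

lemma l2_norm_fdilation: "l2_norm (fdilation j f) = l2_norm f"
proof -
  let ?r = "(2::real) powi (- j)"
  have r: "?r > 0" by simp
  have "(sqrt 2 powi (- j))\<^sup>2 = ?r"
    by (metis power_int_power power_int_power' power_int_mult mult.commute
        real_sqrt_pow2 zero_le_numeral power_int_of_nat)
  then have "(\<integral>x. (cmod (fdilation j f x))\<^sup>2 \<partial>lborel) = ?r * (\<integral>x. (cmod (f (0 + ?r * x)))\<^sup>2 \<partial>lborel)"
    by (simp add: fdilation_def norm_mult norm_power_int power_mult_distrib)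
  also have "\<dots> = (\<integral>x. (cmod (f x))\<^sup>2 \<partial>lborel)"
    using r by (subst (2) lborel_integral_real_affine[of ?r _ 0]) auto
  finally show ?thesis by (simp add: l2_norm_def)
qed

lemma l2_inner_fdilation:
  "f \<in> L2R \<Longrightarrow> g \<in> L2R \<Longrightarrow> l2_inner (fdilation j f) (fdilation j g) = l2_inner f g"
  by (rule l2_inner_isometry[OF subspace_L2R order_refl])
    (auto simp: fdilation_add fdilation_fscale L2R_fdilation l2_norm_fdilation)

lemma fdilation_closed_span:
  assumes "S \<subseteq> L2R" "f \<in> closed_span S"
  shows "fdilation j f \<in> closed_span (fdilation j ` S)"
  by (rule closed_span_image_L2R[OF assms(1) _ assms(2)])
    (use assms closed_span_L2R in
      \<open>auto simp: fdilation_add fdilation_fscale L2R_fdilation l2_norm_fdilation\<close>)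

lemma bounded_support_fdilation:
  assumes "f \<in> bounded_support" shows "fdilation j f \<in> bounded_support"
proof -
  obtain R where R: "\<And>x. R < \<bar>x\<bar> \<Longrightarrow> f x = 0" and f: "f \<in> L2R"
    using assms by (auto simp: bounded_support_def)
  show ?thesis
  proof (rule bounded_supportI[OF L2R_fdilation[OF f], of "R / 2 powi (- j)"])
    fix x :: real assume "R / 2 powi (- j) < \<bar>x\<bar>"
    then have "R < \<bar>2 powi (- j) * x\<bar>" by (simp add: abs_mult divide_less_eq mult.commute del: power_int_minus)
    then show "fdilation j f x = 0" using R by (simp add: fdilation_def)
  qed
qed

lemma dilation_fourier: "int_iter dilation j (fourier g) = fourier (fdilation j g)"
proof
  fix t
  let ?d = "(2::real) powi j" and ?s = "complex_of_real (sqrt 2)"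
  have "?s powi j * (1 / of_real ?d) = ?s powi (- j)"
  proof -
    have "of_real ?d = ?s powi j * ?s powi j"
      by (subst power_int_mult_distrib[symmetric]) (simp flip: of_real_mult)
    then show ?thesis by (simp add: power_int_minus field_simps)
  qed
  moreover have "int_iter dilation j (fourier g) t
      = ?s powi j * fourier (\<lambda>x. g (x / ?d) / of_real ?d) t"
    by (simp add: int_iter_dilation fourier_scale)
  moreover have "\<dots> = fourier (fscale (?s powi j * (1 / of_real ?d)) (\<lambda>x. g (x / ?d))) t"
    unfolding fourier_fscale by (simp add: fscale_def fourier_def mult.assoc)
  moreover have "fscale (?s powi (- j)) (\<lambda>x. g (x / ?d)) = fdilation j g"
    by (simp add: fscale_def fdilation_def power_int_minus field_simps)
  ultimately show "int_iter dilation j (fourier g) t = fourier (fdilation j g) t" by simp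
qed

lemma nn_integral_translate:
  fixes f :: "real \<Rightarrow> ennreal"
  assumes "f \<in> borel_measurable borel"
  shows "(\<integral>\<^sup>+x. f (x - a) \<partial>lborel) = (\<integral>\<^sup>+x. f x \<partial>lborel)"
  using nn_integral_real_affine[OF assms, of 1 "-a"] by simp

section \<open>The generator, and the lift from one period to the line\<close>

context fixes n :: nat begin

definition shift :: real where "shift = 2 ^ n"

definition cut :: real where "cut = shift / (4 * shift - 1)"

lemma shift_ge_1: "1 \<le> shift"
  by (simp add: shift_def)

lemma cut_eq: "4 * (shift * cut) = shift + cut"
  using shift_ge_1 by (simp add: cut_def field_simps)

lemma cut_bounds: "1/4 < cut" "cut < 1/2"
  using shift_ge_1 by (auto simp: cut_def field_simps)

text \<open>The period is cut according to where \<open>lift\<close> sends its points.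
  \<open>piece4\<close> is the set \<open>A\<close> of the overview and \<open>piece5\<close> is its
  double; these two are split between two places, the others move rigidly.\<close>

definition "piece1 = {-(1/2)<..-cut}"
definition "piece2 = {-cut<..0}"
definition "piece3 = {0<..cut/2} \<union> {1/4<..cut}"
definition "piece4 = {cut/2<..1/4::real}"
definition "piece5 = {cut<..1/2}"

lemmas piece_defs = piece1_def piece2_def piece3_def piece4_def piece5_def

text \<open>Known object: the 1-periodic extension of \<open>q\<close> times the transform of the
  wavelet, because all displacements are integers. Thus \<open>lift\<close> identifies functions on
  a period with level 0 of the wavelet system on the frequency side.\<close>

definition lift :: "(real \<Rightarrow> complex) \<Rightarrow> real \<Rightarrow> complex" where
  "lift q x =
     (if x \<in> piece1 then q x
      else if x + shift \<in> piece2 then q (x + shift)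
      else if x - shift \<in> piece3 then q (x - shift)
      else if x \<in> piece4 then q x / sqrt 2
      else if x - shift \<in> piece4 then q (x - shift) / sqrt 2
      else if x \<in> piece5 then q x / sqrt 2
      else if x - 2 * shift \<in> piece5 then - q (x - 2 * shift) / sqrt 2
      else 0)"

text \<open>Each case of \<open>lift\<close> is compared only with the later ones; the remaining
  exclusions are contrapositives.\<close>

lemma piece_disjoint:
  "x \<in> piece1 \<Longrightarrow> x + shift \<notin> piece2 \<and> x - shift \<notin> piece3 \<and> x \<notin> piece4 \<and> x - shift \<notin> piece4
    \<and> x \<notin> piece5 \<and> x - 2 * shift \<notin> piece5"
  "x + shift \<in> piece2 \<Longrightarrow> x - shift \<notin> piece3 \<and> x \<notin> piece4 \<and> x - shift \<notin> piece4
    \<and> x \<notin> piece5 \<and> x - 2 * shift \<notin> piece5"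
  "x - shift \<in> piece3 \<Longrightarrow> x \<notin> piece4 \<and> x - shift \<notin> piece4 \<and> x \<notin> piece5 \<and> x - 2 * shift \<notin> piece5"
  "x \<in> piece4 \<Longrightarrow> x - shift \<notin> piece4 \<and> x \<notin> piece5 \<and> x - 2 * shift \<notin> piece5"
  "x - shift \<in> piece4 \<Longrightarrow> x \<notin> piece5 \<and> x - 2 * shift \<notin> piece5"
  "x \<in> piece5 \<Longrightarrow> x - 2 * shift \<notin> piece5"
  using shift_ge_1 cut_bounds by (auto simp: piece_defs)

lemma piece_sets [measurable]:
  "piece1 \<in> sets borel" "piece2 \<in> sets borel" "piece3 \<in> sets borel" "piece4 \<in> sets borel"
  "piece5 \<in> sets borel"
  by (simp_all add: piece_defs)

lemma piece_unit_interval: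
  "piece1 \<subseteq> unit_interval" "piece2 \<subseteq> unit_interval" "piece3 \<subseteq> unit_interval"
  "piece4 \<subseteq> unit_interval" "piece5 \<subseteq> unit_interval"
  using cut_bounds by (auto simp: piece_defs)

lemma piece_partition:
  "x \<in> unit_interval \<longleftrightarrow> x \<in> piece1 \<or> x \<in> piece2 \<or> x \<in> piece3 \<or> x \<in> piece4 \<or> x \<in> piece5"
  "x \<in> piece1 \<Longrightarrow> x \<notin> piece2 \<and> x \<notin> piece3 \<and> x \<notin> piece4 \<and> x \<notin> piece5"
  "x \<in> piece2 \<Longrightarrow> x \<notin> piece3 \<and> x \<notin> piece4 \<and> x \<notin> piece5"
  "x \<in> piece3 \<Longrightarrow> x \<notin> piece4 \<and> x \<notin> piece5"
  "x \<in> piece4 \<Longrightarrow> x \<notin> piece5"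
  using cut_bounds by (auto simp: piece_defs)

lemma lift_add: "lift (f + g) = lift f + lift g"
  by (rule ext) (simp add: lift_def plus_fun_apply add_divide_distrib diff_divide_distrib)

lemma lift_fscale: "lift (fscale c f) = fscale c (lift f)"
  by (auto simp: lift_def fun_eq_iff fscale_def)

lemma lift_unit_interval: "lift (\<lambda>x. indicator unit_interval x * q x) = lift q"
  using piece_unit_interval
  by (auto simp: lift_def fun_eq_iff indicator_def simp del: greaterThanAtMost_iff)

lemma lift_measurable:
  assumes [measurable]: "q \<in> borel_measurable borel" shows "lift q \<in> borel_measurable borel"
  unfolding lift_def[abs_def] by measurable

text \<open>Translation does not change integrals, and the two pieces that are split occur twice
  with weight 1/2. Working with non-negative integrals yields membership in \<open>L2R\<close> and
  the norm at once.\<close>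

lemma lift_nn_norm:
  assumes [measurable]: "q \<in> borel_measurable borel"
  shows "(\<integral>\<^sup>+x. ennreal ((cmod (lift q x))\<^sup>2) \<partial>lborel)
    = (\<integral>\<^sup>+x. ennreal ((cmod (indicator unit_interval x * q x))\<^sup>2) \<partial>lborel)"
proof -
  define G where "G P x = indicator P x * ennreal ((cmod (q x))\<^sup>2)" for P x
  have [measurable]: "G P \<in> borel_measurable borel" if "P \<in> sets borel" for P
    using that unfolding G_def by measurable
  let ?P1 = piece1 and ?P2 = piece2 and ?P3 = piece3
    and ?P4 = piece4 and ?P5 = piece5 and ?h = "inverse 2 :: ennreal"
  have h: "ennreal (1/2) = ?h" by simp
  let ?I = "\<lambda>P. \<integral>\<^sup>+x. G P x \<partial>lborel"
  have half: "ennreal ((cmod (z / sqrt 2))\<^sup>2) = ?h * ennreal ((cmod z)\<^sup>2)"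
    "ennreal ((cmod (- z / sqrt 2))\<^sup>2) = ?h * ennreal ((cmod z)\<^sup>2)" for z :: complex
  proof -
    have "(cmod (z / sqrt 2))\<^sup>2 = 1/2 * (cmod z)\<^sup>2" "(cmod (- z / sqrt 2))\<^sup>2 = 1/2 * (cmod z)\<^sup>2"
      by (simp_all add: norm_divide power_divide)
    then show "ennreal ((cmod (z / sqrt 2))\<^sup>2) = ?h * ennreal ((cmod z)\<^sup>2)"
      "ennreal ((cmod (- z / sqrt 2))\<^sup>2) = ?h * ennreal ((cmod z)\<^sup>2)"
      by (simp_all only: ennreal_mult' zero_le_divide_1_iff zero_le_numeral h)
  qed
  have G: "G P y = (if y \<in> P then ennreal ((cmod (q y))\<^sup>2) else 0)" for P y
    by (simp add: G_def indicator_def)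
  have pt: "ennreal ((cmod (lift q x))\<^sup>2) = G ?P1 x + (G ?P2 (x + shift) + (G ?P3 (x - shift)
      + ((?h * G ?P4 x + ?h * G ?P4 (x - shift)) + (?h * G ?P5 x + ?h * G ?P5 (x - 2 * shift)))))" for x
  proof -
    consider "x \<in> piece1" | "x + shift \<in> piece2" | "x - shift \<in> piece3" | "x \<in> piece4"
      | "x - shift \<in> piece4" | "x \<in> piece5" | "x - 2 * shift \<in> piece5"
      | "x \<notin> piece1" "x + shift \<notin> piece2" "x - shift \<notin> piece3" "x \<notin> piece4"
        "x - shift \<notin> piece4" "x \<notin> piece5" "x - 2 * shift \<notin> piece5"
      by blast
    then show ?thesis
    proof cases
      case 1 with piece_disjoint[of x] show ?thesis by (simp add: lift_def G)
    next
      case 2 with piece_disjoint[of x] have "x \<notin> piece1" by blast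
      with 2 piece_disjoint[of x] show ?thesis by (simp add: lift_def G)
    next
      case 3 with piece_disjoint[of x] have "x \<notin> piece1" "x + shift \<notin> piece2" by blast+
      with 3 piece_disjoint[of x] show ?thesis by (simp add: lift_def G)
    next
      case 4 with piece_disjoint[of x] have "x \<notin> piece1" "x + shift \<notin> piece2" "x - shift \<notin> piece3" by blast+
      with 4 piece_disjoint[of x] show ?thesis using half(1)[of "q x"] by (simp add: lift_def G)
    next
      case 5 with piece_disjoint[of x] have "x \<notin> piece1" "x + shift \<notin> piece2" "x - shift \<notin> piece3"
        "x \<notin> piece4" by blast+
      with 5 piece_disjoint[of x] show ?thesis using half(1)[of "q (x - shift)"] by (simp add: lift_def G)
    next
      case 6 with piece_disjoint[of x] have "x \<notin> piece1" "x + shift \<notin> piece2" "x - shift \<notin> piece3"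
        "x \<notin> piece4" "x - shift \<notin> piece4" by blast+
      with 6 piece_disjoint[of x] show ?thesis using half(1)[of "q x"] by (simp add: lift_def G)
    next
      case 7 with piece_disjoint[of x] have "x \<notin> piece1" "x + shift \<notin> piece2" "x - shift \<notin> piece3"
        "x \<notin> piece4" "x - shift \<notin> piece4" "x \<notin> piece5" by blast+
      with 7 show ?thesis using half(2)[of "q (x - 2 * shift)"] by (simp add: lift_def G)
    next
      case 8 then show ?thesis by (simp add: lift_def G)
    qed
  qed
  have "?h + ?h = ennreal (1/2 + 1/2)"
    unfolding h[symmetric] by (rule ennreal_plus[symmetric]) auto
  then have "?h + ?h = 1" by simp
  then have hh: "?h * z + ?h * z = z" for z by (simp only: distrib_right[symmetric] mult_1_left)
  have "(\<integral>\<^sup>+x. ennreal ((cmod (lift q x))\<^sup>2) \<partial>lborel)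
      = ?I ?P1 + (?I ?P2 + (?I ?P3 + ((?h * ?I ?P4 + ?h * ?I ?P4) + (?h * ?I ?P5 + ?h * ?I ?P5))))"
    unfolding pt
    using nn_integral_translate[of "G ?P2" "- shift"]
    by (simp add: nn_integral_add nn_integral_cmult nn_integral_translate[of "G _"])
  also have "\<dots> = (\<integral>\<^sup>+x. G ?P1 x + (G ?P2 x + (G ?P3 x + (G ?P4 x + G ?P5 x))) \<partial>lborel)"
    unfolding hh by (simp add: nn_integral_add)
  also have "\<dots> = (\<integral>\<^sup>+x. ennreal ((cmod (indicator unit_interval x * q x))\<^sup>2) \<partial>lborel)"
  proof (rule nn_integral_cong)
    fix x
    show "G ?P1 x + (G ?P2 x + (G ?P3 x + (G ?P4 x + G ?P5 x)))
        = ennreal ((cmod (indicator unit_interval x * q x))\<^sup>2)"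
      using piece_partition[of x] unfolding G indicator_def by auto
  qed
  finally show ?thesis .
qed

lemma L2R_restrict_unit_interval: "q \<in> L2R \<Longrightarrow> (\<lambda>x. indicator unit_interval x * q x) \<in> L2R"
  by (rule L2R_mult_bounded[where C = 1]) (auto simp: indicator_def)

lemma L2R_lift: "q \<in> L2R \<Longrightarrow> lift q \<in> L2R"
  using L2R_restrict_unit_interval[of q] lift_nn_norm[of q]
  by (auto simp: L2R_iff_nn intro: lift_measurable)

lemma l2_norm_lift: "q \<in> L2R \<Longrightarrow> l2_norm (lift q) = l2_norm (\<lambda>x. indicator unit_interval x * q x)"
  by (rule l2_norm_eqI) (simp_all only: L2R_lift L2R_restrict_unit_interval lift_nn_norm L2R_measurable)

lemma bounded_support_lift: "q \<in> L2R \<Longrightarrow> lift q \<in> bounded_support"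
  using shift_ge_1 cut_bounds
  by (intro bounded_supportI[of _ "2 * shift + 1"]) (auto simp: L2R_lift lift_def piece_defs)

text \<open>\<open>lift\<close> is a linear contraction, so the completeness of the trigonometric
  system on the period carries over.\<close>

lemma lift_closed_span:
  assumes "q \<in> L2R" shows "lift q \<in> closed_span (range (\<lambda>l. lift (trig l)))"
proof -
  let ?q = "\<lambda>x. indicator unit_interval x * q x"
  have "lift ?q \<in> closed_span (lift ` range trig)"
  proof (rule closed_span_image_L2R)
    show "?q \<in> closed_span (range trig)" by (rule trig_closed_span[OF assms])
    show "l2_norm (lift g) \<le> l2_norm g" if g: "g \<in> L2R" for g
      unfolding l2_norm_lift[OF g]
      by (rule l2_norm_le[OF g L2R_measurable[OF L2R_restrict_unit_interval[OF g]]])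
        (auto simp: indicator_def)
  qed (auto simp: lift_add lift_fscale L2R_lift L2R_restrict_unit_interval assms)
  then show ?thesis by (simp add: lift_unit_interval image_comp comp_def)
qed

lemma lift_trig_orthonormal: "l2_inner (lift (trig l)) (lift (trig m)) = (if l = m then 1 else 0)"
proof -
  \<comment> \<open>On all of \<open>L2R\<close> the map \<open>lift\<close> forgets what lies
    outside the period; it is isometric on this subspace, whose elements vanish there.\<close>
  let ?B = "cfun.span (range trig)"
  have B: "?B \<subseteq> L2R" by (rule L2R_span) auto
  have r: "(\<lambda>x. indicator unit_interval x * q x) = q" if "q \<in> ?B" for q
    using that
  proof (induction rule: cfun.span_induct_alt)
    case base then show ?case by (simp add: zero_fun_def)
  next
    case (step c x y)
    then have y: "indicator unit_interval t * y t = y t" for t by (metis (no_types))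
    show ?case using step(1) 
      by (auto simp: fun_eq_iff fscale_def plus_fun_apply trig_def distrib_left y)
        (auto simp: indicator_def)
  qed
  have "l2_inner (lift (trig l)) (lift (trig m)) = l2_inner (trig l) (trig m)"
  proof (rule l2_inner_isometry[OF cfun.subspace_span B])
    show "l2_norm (lift g) = l2_norm g" if "g \<in> ?B" for g
      using l2_norm_lift[of g] B r[OF that] that by auto
  qed (use B in \<open>auto simp: lift_add lift_fscale L2R_lift intro: cfun.span_base\<close>)
  then show ?thesis by (simp add: trig_orthonormal)
qed

definition psi_hat :: "real \<Rightarrow> complex" where "psi_hat = lift (\<lambda>x. 1)"

text \<open>The source of the invariance: \<open>lift\<close> moves points by multiples of
  \<open>shift\<close> only, so a character that is trivial at \<open>shift\<close> passes through
  it, even when its frequency is a fraction with denominator \<open>2 ^ n\<close>.\<close>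

lemma lift_character:
  assumes "\<theta> * shift = of_int k"
  shows "lift (character \<theta>) = (\<lambda>x. character \<theta> x * psi_hat x)"
proof -
  have "\<theta> * (- shift) = of_int (- k)" "\<theta> * (- 2 * shift) = of_int (- 2 * k)"
    using assms by auto
  note * = character_shift_int[OF assms] character_shift_int[OF this(1)] character_shift_int[OF this(2)]
  then have "character \<theta> (x - shift) = character \<theta> x" "character \<theta> (x - 2 * shift) = character \<theta> x" for x
    by (metis uminus_add_conv_diff add.commute mult_minus_left)+
  then show ?thesis by (auto simp: psi_hat_def lift_def fun_eq_iff *(1))
qed

lemma lift_trig: "lift (trig l) = (\<lambda>x. character (of_int l) x * psi_hat x)"
proof -
  have "lift (trig l) = lift (character (of_int l))" by (simp add: trig_def lift_unit_interval)
  also have "\<dots> = (\<lambda>x. character (of_int l) x * psi_hat x)"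
    by (rule lift_character[of _ "l * 2 ^ n"]) (simp add: shift_def)
  finally show ?thesis .
qed

section \<open>Overlaps between dyadic levels\<close>

lemma psi_hat_support:
  assumes "psi_hat x \<noteq> 0"
  shows "x \<in> {-1/2<..-cut} \<or> x \<in> {-shift-cut<..-shift} \<or> x \<in> {cut/2<..1/4} \<or> x \<in> {cut<..1/2}
    \<or> x \<in> {shift<..shift+cut} \<or> x \<in> {2 * shift+cut<..2 * shift+1/2}"
  using assms cut_bounds unfolding psi_hat_def lift_def piece_defs by (auto split: if_splits)

text \<open>No power of two lies strictly between two consecutive ones. This supplies the
  discreteness of scales to the linear arithmetic below.\<close>

lemma power_2_gap: "(2::real) ^ m < 2 ^ j \<Longrightarrow> 2 * 2 ^ m \<le> (2::real) ^ j"
  by (metis Suc_leI one_less_numeral_iff power_Suc power_increasing power_strict_increasing_iff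
      semiring_norm(76) one_le_numeral)

lemma psi_hat_product_0:
  assumes "j \<ge> 2" shows "psi_hat x * psi_hat (2 ^ j * x) = 0"
proof (rule ccontr)
  assume "psi_hat x * psi_hat (2 ^ j * x) \<noteq> 0"
  then have nz: "psi_hat x \<noteq> 0" "psi_hat (2 ^ j * x) \<noteq> 0" by auto
  define M :: real where "M = 2 ^ j"
  have M4: "M \<ge> 4" using power_increasing[OF assms, of "2::real"] by (simp add: M_def)
  \<comment> \<open>The idea of the case analysis: a dilate that reaches past \<open>shift\<close>
    has \<open>M > 2 * shift\<close>, hence \<open>M \<ge> 4 * shift\<close>, and then it starts
    beyond \<open>shift + cut\<close>, so it jumps over the target interval. The other targets and
    starting intervals need the next two powers.\<close>
  have gap: "2 * shift < M \<Longrightarrow> 4 * shift \<le> M" "4 * shift < M \<Longrightarrow> 8 * shift \<le> M"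
    "8 * shift < M \<Longrightarrow> 16 * shift \<le> M"
    using power_2_gap[of "n + 1" j] power_2_gap[of "n + 2" j] power_2_gap[of "n + 3" j]
    by (auto simp: shift_def M_def power_add)
  \<comment> \<open>The nonlinear terms get names; \<open>cut\<close> below bounds \<open>D\<close>
    through the identity \<open>4 * (shift * cut) = shift + cut\<close>, after which all cases are
    linear.\<close>
  define D where "D = M * cut"
  define y where "y = M * x"
  have Mcut: "a * (shift * cut) \<le> D" if "a * shift \<le> M" for a
    using mult_right_mono[OF that, of cut] cut_bounds unfolding D_def by (simp only: mult.assoc)
  have cut: "4 * shift \<le> M \<Longrightarrow> shift + cut \<le> D" "8 * shift \<le> M \<Longrightarrow> 2 * shift + 2 * cut \<le> D"
    "16 * shift \<le> M \<Longrightarrow> 4 * shift + 4 * cut \<le> D"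
    using Mcut[of 4] Mcut[of 8] Mcut[of 16] cut_eq by auto
  have D: "4 * cut \<le> D" using M4 cut_bounds by (simp add: D_def)
  note facts = shift_ge_1 cut_bounds gap cut D M4
  have upper: "4 * shift < y" if "shift < x"
  proof -
    have "4 * shift \<le> M * shift" using M4 shift_ge_1 by (intro mult_right_mono) auto
    also have "\<dots> < y" using that M4 by (simp add: y_def)
    finally show ?thesis .
  qed
  have lower: "y \<le> - (4 * shift)" if "x \<le> - shift"
  proof -
    have "y \<le> M * - shift" unfolding y_def using that M4 by (intro mult_left_mono) auto
    moreover have "4 * shift \<le> M * shift" using M4 shift_ge_1 by (intro mult_right_mono) auto
    ultimately show ?thesis by simp
  qed
  have y: "y \<in> {-1/2<..-cut} \<or> y \<in> {-shift-cut<..-shift} \<or> y \<in> {cut/2<..1/4}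
    \<or> y \<in> {cut<..1/2} \<or> y \<in> {shift<..shift+cut} \<or> y \<in> {2 * shift+cut<..2 * shift+1/2}"
    using psi_hat_support[OF nz(2)] by (simp add: M_def y_def)
  from psi_hat_support[OF nz(1)] show False
  proof (elim disjE)
    assume "x \<in> {-1/2<..-cut}"
    then have "M * - (1/2) < M * x" "M * x \<le> M * - cut"
      using M4 by (intro mult_strict_left_mono mult_left_mono; simp)+
    then have "- M / 2 < y" "y \<le> - D" unfolding y_def D_def by linarith+
    with y facts show False by auto
  next
    assume "x \<in> {-shift-cut<..-shift}"
    with lower y facts show False by auto
  next
    assume "x \<in> {cut/2<..1/4}"
    then have "D / 2 < y" "y \<le> M / 4" using M4 by (auto simp: y_def D_def)
    with y facts show False by auto
  next
    assume "x \<in> {cut<..1/2}"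
    then have "D < y" "y \<le> M / 2" using M4 by (auto simp: y_def D_def)
    with y facts show False by auto
  next
    assume "x \<in> {shift<..shift+cut}"
    with upper y facts show False by auto
  next
    assume "x \<in> {2 * shift+cut<..2 * shift+1/2}"
    with upper y facts show False by auto
  qed
qed

text \<open>Doubling maps \<open>piece4\<close> onto \<open>piece5\<close>, and its translate by
  \<open>shift\<close> onto the translate of \<open>piece5\<close> by \<open>2 * shift\<close>,
  where \<open>lift\<close> carries the minus sign. These are the only overlaps with the next level,
  and they have opposite signs.\<close>

lemma psi_hat_product_1:
  "psi_hat x * psi_hat (2 * x) = (indicator piece4 x - indicator piece4 (x - shift)) / 2"
proof -
  let ?s = "1 / complex_of_real (sqrt 2)"
  have ss: "?s * ?s = 1 / 2" by (simp flip: of_real_mult)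
  consider "x \<in> piece4" | "x - shift \<in> piece4" | "x \<notin> piece4" "x - shift \<notin> piece4" by blast
  then show ?thesis
  proof cases
    case 1
    then have "psi_hat x = ?s" "psi_hat (2 * x) = ?s" "x - shift \<notin> piece4"
      using cut_bounds shift_ge_1 by (auto simp: psi_hat_def lift_def piece_defs)
    then show ?thesis using 1 ss by simp
  next
    case 2
    then have "psi_hat x = ?s" "psi_hat (2 * x) = - ?s" "x \<notin> piece4"
      using cut_bounds shift_ge_1 by (auto simp: psi_hat_def lift_def piece_defs)
    then show ?thesis using 2 ss by simp
  next
    case 3
    have "psi_hat x = 0 \<or> psi_hat (2 * x) = 0"
    proof (rule ccontr)
      assume "\<not> ?thesis"
      then have "psi_hat x \<noteq> 0" "psi_hat (2 * x) \<noteq> 0" by auto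
      from psi_hat_support[OF this(1)] psi_hat_support[OF this(2)] show False
        using 3 shift_ge_1 cut_bounds by (auto simp: piece4_def)
    qed
    then show ?thesis using 3 by auto
  qed
qed

lemma cnj_psi_hat [simp]: "cnj (psi_hat x) = psi_hat x"
  by (simp add: psi_hat_def lift_def)

lemma lift_indicator:
  "A \<subseteq> piece1 \<Longrightarrow> lift (indicator A) x = indicator A x"
  "A \<subseteq> piece2 \<Longrightarrow> lift (indicator A) x = indicator A (x + shift)"
  "A \<subseteq> piece3 \<Longrightarrow> lift (indicator A) x = indicator A (x - shift)"
  "A \<subseteq> piece4 \<Longrightarrow> lift (indicator A) x = (indicator A x + indicator A (x - shift)) / complex_of_real (sqrt 2)"
  "A \<subseteq> piece5 \<Longrightarrow> lift (indicator A) x = (indicator A x - indicator A (x - 2 * shift)) / complex_of_real (sqrt 2)"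
proof -
  have out: "indicator A y = (0 :: complex)" if "A \<subseteq> P" "y \<notin> P" for P y
    using that by (auto simp: indicator_def)
  note pp = piece_partition[of x] piece_partition[of "x + shift"] piece_partition[of "x - shift"]
    piece_partition[of "x - 2 * shift"] piece_disjoint[of x]
  show "A \<subseteq> piece1 \<Longrightarrow> lift (indicator A) x = indicator A x"
    unfolding lift_def using out[of piece1] pp by (smt (verit, best) div_0 minus_zero)
  show "A \<subseteq> piece2 \<Longrightarrow> lift (indicator A) x = indicator A (x + shift)"
    unfolding lift_def using out[of piece2] pp by (smt (verit, best) div_0 minus_zero)
  show "A \<subseteq> piece3 \<Longrightarrow> lift (indicator A) x = indicator A (x - shift)"
    unfolding lift_def using out[of piece3] pp by (smt (verit, best) div_0 minus_zero)
  show "A \<subseteq> piece4 \<Longrightarrow> lift (indicator A) x = (indicator A x + indicator A (x - shift)) / complex_of_real (sqrt 2)"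
    unfolding lift_def using out[of piece4] pp by (smt (verit, best) div_0 minus_zero add.right_neutral add.left_neutral)
  show "A \<subseteq> piece5 \<Longrightarrow> lift (indicator A) x = (indicator A x - indicator A (x - 2 * shift)) / complex_of_real (sqrt 2)"
    unfolding lift_def using out[of piece5] pp by (smt (verit, best) div_0 minus_zero diff_0_right diff_0)
qed

end

section \<open>The wavelet system and its core space\<close>

text \<open>Both halves of the result are read off the first factor. It vanishes for integer
  \<open>\<theta>\<close>, which gives orthogonality of neighbouring levels, and it is 1 for
  \<open>\<theta> = - 1 / (2 * shift n)\<close>, which breaks the finer invariance.\<close>

lemma integral_character_psi_hat:
  "(\<integral>x. character \<theta> x * (psi_hat n x * psi_hat n (2 * x)) \<partial>lborel)
    = (1 - character \<theta> (shift n)) / 2 * (\<integral>x. character \<theta> x * indicator (piece4 n) x \<partial>lborel)"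
proof -
  let ?P = "piece4 n" and ?d = "shift n"
  let ?f = "\<lambda>x. character \<theta> x * indicator ?P x :: complex"
  have "integrable lborel (indicator ?P :: real \<Rightarrow> complex)"
    using bounded_support_integrable[OF bounded_support_indicator_Ioc] by (simp add: piece4_def)
  then have f: "integrable lborel ?f"
    using integrable_mult_character[of "indicator ?P" \<theta>]
    by (simp add: mult.commute character_commute[of \<theta>])
  have sh: "character \<theta> x * indicator ?P (x - ?d) = character \<theta> ?d * ?f (- ?d + 1 * x)" for x
    using character_add_right[of \<theta> "x - ?d" ?d] by (simp add: algebra_simps)
  have fs: "integrable lborel (\<lambda>x. ?f (- ?d + 1 * x))"
    by (rule lborel_integrable_real_affine[OF f]) simp
  have "(\<integral>x. character \<theta> x * (psi_hat n x * psi_hat n (2 * x)) \<partial>lborel)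
      = (\<integral>x. (?f x - character \<theta> ?d * ?f (- ?d + 1 * x)) / 2 \<partial>lborel)"
    unfolding psi_hat_product_1 sh[symmetric]
    by (intro Bochner_Integration.integral_cong refl) (simp add: algebra_simps)
  also have "\<dots> = ((\<integral>x. ?f x \<partial>lborel) - character \<theta> ?d * (\<integral>x. ?f (- ?d + 1 * x) \<partial>lborel)) / 2"
    using f fs by simp
  also have "(\<integral>x. ?f (- ?d + 1 * x) \<partial>lborel) = (\<integral>x. ?f x \<partial>lborel)"
    using lborel_integral_real_affine[of 1 ?f "- ?d"] by simp
  finally show ?thesis by (simp add: algebra_simps)
qed

text \<open>The sign of \<open>l\<close> is that of modulation: translation by \<open>l\<close>
  multiplies the frequency side by the character of frequency \<open>- l\<close>.\<close>

definition freq_system :: "nat \<Rightarrow> int \<times> int \<Rightarrow> real \<Rightarrow> complex" where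
  "freq_system n = (\<lambda>(j, l). fdilation j (lift n (trig (- l))))"

lemma freq_system_bounded_support: "freq_system n i \<in> bounded_support"
  by (auto simp: freq_system_def split: prod.split intro!: bounded_support_fdilation bounded_support_lift)

lemma freq_system_L2R: "freq_system n i \<in> L2R"
  using freq_system_bounded_support bounded_support_L2R by blast

lemma range_freq_system: "range (freq_system n) \<subseteq> L2R"
  using freq_system_L2R by auto

lemma fdilation_freq_system: "fdilation k (freq_system n (j, l)) = freq_system n (k + j, l)"
  by (simp add: freq_system_def fdilation_fdilation)

definition psi :: "nat \<Rightarrow> real \<Rightarrow> complex" where "psi n = fourier (psi_hat n)"

lemma wavelet_system_psi: "wavelet_system (psi n) i = fourier (freq_system n i)"
proof -
  obtain j l where i: "i = (j, l)" by force
  have "int_iter (translation 1) l (psi n) = translation (of_int l) (psi n)"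
    by (simp add: int_iter_translation translation_def)
  then show ?thesis
    by (simp add: i wavelet_system_def psi_def translation_fourier dilation_fourier freq_system_def lift_trig)
qed

lemma l2_inner_fdilation_lift_trig:
  assumes "j \<ge> 1"
  shows "l2_inner (fdilation (int j) (lift n (trig a))) (lift n (trig b)) = 0"
proof (cases "j \<ge> 2")
  case True
  have "psi_hat n (2 powi (- int j) * x) * psi_hat n x = 0" for x
  proof -
    have "2 ^ j * (2 powi (- int j) * x) = x" by (simp add: power_int_minus mult.assoc[symmetric])
    then show ?thesis using psi_hat_product_0[OF True, of n "2 powi (- int j) * x"] by (simp only:)
  qed
  then have "(\<lambda>x. fdilation (int j) (lift n (trig a)) x * cnj (lift n (trig b) x)) = (\<lambda>x. 0)"
    unfolding fdilation_def lift_trig by (auto simp: fun_eq_iff)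
  then show ?thesis by (simp only: l2_inner_def) simp
next
  case False
  with assms have j: "j = 1" by simp
  let ?f = "\<lambda>x. fdilation 1 (lift n (trig a)) x * cnj (lift n (trig b) x)"
  \<comment> \<open>The substitution of \<open>2 * x\<close> doubles the frequency \<open>b\<close>
    of the undilated factor and leaves \<open>a\<close> for the dilated one.\<close>
  let ?\<theta> = "of_int (a - 2 * b) :: real"
  have "?f (0 + 2 * x) = complex_of_real (sqrt 2) powi (- 1)
      * (character ?\<theta> x * (psi_hat n x * psi_hat n (2 * x)))" for x
    by (simp add: fdilation_def lift_trig character_def cis_mult cis_cnj algebra_simps)
  then have "l2_inner (fdilation 1 (lift n (trig a))) (lift n (trig b))
      = 2 * (complex_of_real (sqrt 2) powi (- 1)
        * (\<integral>x. character ?\<theta> x * (psi_hat n x * psi_hat n (2 * x)) \<partial>lborel))"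
    unfolding l2_inner_def by (subst lborel_integral_real_affine[of 2 _ 0]) (simp_all add: scaleR_conv_of_real)
  moreover have "character ?\<theta> (shift n) = 1"
    by (rule character_int[of _ _ "(a - 2 * b) * 2 ^ n"]) (simp add: shift_def)
  ultimately show ?thesis unfolding integral_character_psi_hat j by simp
qed

lemma freq_system_orthonormal:
  "l2_inner (freq_system n i) (freq_system n i') = (if i = i' then 1 else 0)"
proof -
  \<comment> \<open>Dilations are unitary, so the lower of the two levels may be moved to 0.\<close>
  have less: "l2_inner (freq_system n (j, l)) (freq_system n (k, m)) = 0" if "k < j" for j k l m
  proof -
    have "freq_system n (j, l) = fdilation k (fdilation (int (nat (j - k))) (lift n (trig (- l))))"
      using that by (simp add: freq_system_def fdilation_fdilation)
    moreover have "freq_system n (k, m) = fdilation k (lift n (trig (- m)))"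
      by (simp add: freq_system_def)
    ultimately show ?thesis
      using l2_inner_fdilation_lift_trig[of "nat (j - k)" n "- l" "- m"] that
      by (simp add: l2_inner_fdilation L2R_fdilation L2R_lift)
  qed
  obtain j l k m where i: "i = (j, l)" "i' = (k, m)" by force
  consider "j < k" | "k < j" | "j = k" by linarith
  then show ?thesis
  proof cases
    case 1
    then show ?thesis using less[OF 1, of m l] l2_inner_cnj[of "freq_system n i'" "freq_system n i"]
      by (simp add: i)
  next
    case 2
    then show ?thesis using less by (simp add: i)
  next
    case 3
    then show ?thesis by (simp add: i freq_system_def l2_inner_fdilation L2R_lift lift_trig_orthonormal)
  qed
qed

lemma closed_span_fdilation_invariant:
  assumes "f \<in> closed_span (range (freq_system n))"
  shows "fdilation k f \<in> closed_span (range (freq_system n))"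
proof -
  have "fdilation k f \<in> closed_span (fdilation k ` range (freq_system n))"
    by (rule fdilation_closed_span[OF range_freq_system assms])
  also have "\<dots> \<subseteq> closed_span (range (freq_system n))"
    by (rule closed_span_mono_closed[OF _ range_freq_system])
      (auto simp: fdilation_freq_system intro!: closed_span_base freq_system_L2R)
  finally show ?thesis .
qed

lemma fdilation_lift_closed_span:
  assumes "q \<in> L2R"
  shows "fdilation j (lift n q) \<in> closed_span (range (\<lambda>l. freq_system n (j, l)))"
proof -
  have L: "range (\<lambda>l. lift n (trig l)) \<subseteq> L2R" by (auto simp: L2R_lift)
  have "fdilation j ` range (\<lambda>l. lift n (trig l)) = range (\<lambda>l. freq_system n (j, l))"
  proof (unfold image_image, intro equalityI image_subsetI)
    fix l
    show "fdilation j (lift n (trig l)) \<in> range (\<lambda>l. freq_system n (j, l))"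
      by (rule range_eqI[of _ _ "- l"]) (simp add: freq_system_def)
    show "freq_system n (j, l) \<in> range (\<lambda>l. fdilation j (lift n (trig l)))"
      by (rule range_eqI[of _ _ "- l"]) (simp add: freq_system_def)
  qed
  with fdilation_closed_span[OF L lift_closed_span[OF assms], of j] show ?thesis by simp
qed

section \<open>Completeness of the frequency system\<close>

context fixes n :: nat begin

text \<open>Quantifying over all subintervals makes the predicate stable under joining adjacent
  intervals and under dyadic scaling, so one octave on each side of 0 generates everything.\<close>

definition covers :: "real \<Rightarrow> real \<Rightarrow> bool" where
  "covers a b \<longleftrightarrow> (\<forall>x y. a \<le> x \<longrightarrow> x < y \<longrightarrow> y \<le> b
     \<longrightarrow> indicator {x<..y} \<in> closed_span (range (freq_system n)))"

lemma coversI: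
  "(\<And>x y. a \<le> x \<Longrightarrow> x < y \<Longrightarrow> y \<le> b \<Longrightarrow> indicator {x<..y} \<in> closed_span (range (freq_system n)))
    \<Longrightarrow> covers a b"
  by (simp add: covers_def)

lemma coversD:
  "covers a b \<Longrightarrow> a \<le> x \<Longrightarrow> x < y \<Longrightarrow> y \<le> b \<Longrightarrow> indicator {x<..y} \<in> closed_span (range (freq_system n))"
  by (simp add: covers_def)

lemma lift_in_closed_span: "q \<in> L2R \<Longrightarrow> lift n q \<in> closed_span (range (freq_system n))"
proof -
  assume "q \<in> L2R"
  then have "lift n q \<in> closed_span (range (\<lambda>l. freq_system n (0, l)))"
    using fdilation_lift_closed_span[of q 0 n] by simp
  also have "\<dots> \<subseteq> closed_span (range (freq_system n))"
    by (rule closed_span_mono_closed[OF _ range_freq_system])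
      (auto intro!: closed_span_base freq_system_L2R)
  finally show ?thesis .
qed

lemma covers_join:
  assumes "covers a b" "covers b d" shows "covers a d"
proof (rule coversI)
  fix x y assume xy: "a \<le> x" "x < y" "y \<le> d"
  show "indicator {x<..y} \<in> closed_span (range (freq_system n))"
  proof (cases "y \<le> b \<or> b \<le> x")
    case True
    then show ?thesis using coversD[OF assms(1)] coversD[OF assms(2)] xy by auto
  next
    case False
    then have "indicator {x<..b} \<in> closed_span (range (freq_system n))"
      "indicator {b<..y} \<in> closed_span (range (freq_system n))"
      using coversD[OF assms(1)] coversD[OF assms(2)] xy by auto
    moreover have "(indicator {x<..y} :: real \<Rightarrow> complex) = indicator {x<..b} + indicator {b<..y}"
      using False by (auto simp: fun_eq_iff plus_fun_apply indicator_def)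
    ultimately show ?thesis by (simp add: closed_span_add range_freq_system)
  qed
qed

lemma covers_scale:
  assumes "covers a b" shows "covers (2 powi k * a) (2 powi k * b)"
proof (rule coversI)
  fix x y assume xy: "2 powi k * a \<le> x" "x < y" "y \<le> 2 powi k * b"
  let ?d = "(2::real) powi (- k)"
  have d: "?d > 0" "?d * 2 powi k = 1" by (simp_all add: power_int_minus)
  have "?d * (2 powi k * a) \<le> ?d * x" "?d * y \<le> ?d * (2 powi k * b)" "?d * x < ?d * y"
    using xy d(1) by (auto intro!: mult_left_mono mult_strict_left_mono)
  then have "indicator {?d * x<..?d * y} \<in> closed_span (range (freq_system n))"
    using d(2) by (intro coversD[OF assms]) (simp_all add: mult.assoc[symmetric])
  then have "fscale (complex_of_real (sqrt 2) powi k) (fdilation k (indicator {?d * x<..?d * y}))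
      \<in> closed_span (range (freq_system n))"
    by (intro closed_span_fscale closed_span_fdilation_invariant range_freq_system)
  moreover have "fscale (complex_of_real (sqrt 2) powi k) (fdilation k (indicator {?d * x<..?d * y}))
      = (indicator {x<..y} :: real \<Rightarrow> complex)"
    by (auto simp: fscale_def fdilation_def fun_eq_iff indicator_def power_int_minus)
  ultimately show "indicator {x<..y} \<in> closed_span (range (freq_system n))" by simp
qed

text \<open>On pieces that \<open>lift\<close> moves rigidly, the indicator of a subinterval is
  itself a lift, hence a limit of elements of level 0.\<close>

lemma covers_piece1: "covers (-1/2) (- cut n)"
proof (rule coversI)
  fix x y assume "-1/2 \<le> x" "x < y" "y \<le> - cut n"
  then have "{x<..y} \<subseteq> piece1 n" by (auto simp: piece1_def)
  then have "indicator {x<..y} = lift n (indicator {x<..y})"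
    by (auto simp: fun_eq_iff lift_indicator(1))
  then show "indicator {x<..y} \<in> closed_span (range (freq_system n))"
    using lift_in_closed_span[OF L2R_indicator_Ioc] by metis
qed

lemma covers_piece2: "covers (- shift n - cut n) (- shift n)"
proof (rule coversI)
  fix x y assume "- shift n - cut n \<le> x" "x < y" "y \<le> - shift n"
  then have "{x + shift n<..y + shift n} \<subseteq> piece2 n" by (auto simp: piece2_def)
  then have "indicator {x<..y} = lift n (indicator {x + shift n<..y + shift n})"
    by (simp add: fun_eq_iff lift_indicator(2)) (simp add: indicator_def)
  then show "indicator {x<..y} \<in> closed_span (range (freq_system n))"
    using lift_in_closed_span[OF L2R_indicator_Ioc] by metis
qed

lemma covers_piece3: "covers (shift n) (shift n + cut n / 2)" "covers (shift n + 1/4) (shift n + cut n)"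
proof -
  have *: "indicator {x<..y} \<in> closed_span (range (freq_system n))"
    if "{x - shift n<..y - shift n} \<subseteq> piece3 n" for x y
  proof -
    have "indicator {x<..y} = lift n (indicator {x - shift n<..y - shift n})"
      by (simp add: fun_eq_iff lift_indicator(3)[OF that]) (simp add: indicator_def)
    then show ?thesis using lift_in_closed_span[OF L2R_indicator_Ioc] by metis
  qed
  show "covers (shift n) (shift n + cut n / 2)" "covers (shift n + 1/4) (shift n + cut n)"
    by (rule coversI, rule *, auto simp: piece3_def)+
qed

text \<open>On \<open>piece4\<close> the generator and its dilate see the pair of points \<open>x\<close>, \<open>x + shift\<close>
  through the rows of an invertible matrix, so both indicators can be separated.\<close>

lemma covers_piece4: "covers (cut n / 2) (1/4)" "covers (shift n + cut n / 2) (shift n + 1/4)"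
proof -
  let ?H = "closed_span (range (freq_system n))"
  have both: "indicator {x<..y} \<in> ?H \<and> indicator {x + shift n<..y + shift n} \<in> ?H"
    if xy: "cut n / 2 \<le> x" "x < y" "y \<le> 1/4" for x y
  proof -
    let ?u = "indicator {x<..y} :: real \<Rightarrow> complex"
    let ?v = "indicator {x + shift n<..y + shift n} :: real \<Rightarrow> complex"
    have p4: "{x<..y} \<subseteq> piece4 n" and p5: "{2 * x<..2 * y} \<subseteq> piece5 n"
      using xy by (auto simp: piece4_def piece5_def)
    have "?u + ?v = fscale (sqrt 2) (lift n ?u)"
      by (auto simp: fun_eq_iff plus_fun_apply fscale_def lift_indicator(4)[OF p4] indicator_def)
    then have s: "?u + ?v \<in> ?H"
      by (simp add: closed_span_fscale range_freq_system lift_in_closed_span L2R_indicator_Ioc)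
    have "?u - ?v = fdilation (- 1) (lift n (indicator {2 * x<..2 * y}))"
      by (auto simp: fun_eq_iff minus_apply fdilation_def lift_indicator(5)[OF p5] indicator_def)
    then have d: "?u - ?v \<in> ?H"
      by (simp add: closed_span_fdilation_invariant lift_in_closed_span L2R_indicator_Ioc)
    have "?u = fscale (1/2) ((?u + ?v) + (?u - ?v))" "?v = fscale (1/2) ((?u + ?v) - (?u - ?v))"
      unfolding fun_eq_iff plus_fun_apply minus_apply fscale_def by simp_all
    then show ?thesis
      using s d by (metis closed_span_fscale closed_span_add closed_span_diff range_freq_system)
  qed
  show "covers (cut n / 2) (1/4)" using both by (intro coversI) auto
  show "covers (shift n + cut n / 2) (shift n + 1/4)"
  proof (rule coversI)
    fix x y assume "shift n + cut n / 2 \<le> x" "x < y" "y \<le> shift n + 1/4"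
    then show "indicator {x<..y} \<in> ?H" using both[of "x - shift n" "y - shift n"] by simp
  qed
qed

text \<open>The dyadic tiling: by \<open>cut_eq\<close>, division by \<open>4 * shift n\<close>
  sends the block above \<open>shift n\<close> to \<open>(1/4, cut n]\<close>, which continues
  \<open>piece4\<close>, and division by \<open>2 * shift n\<close> sends the block below
  \<open>- shift n\<close> to \<open>(- 2 * cut n, -1/2]\<close>, which precedes
  \<open>piece1\<close>.\<close>

lemma covers_octaves: "covers (cut n / 2) (cut n)" "covers (- 2 * cut n) (- cut n)"
proof -
  have p: "(2::real) powi (- int (n + k)) = 1 / (2 ^ k * shift n)" for k
  proof -
    have "(2::real) powi (- int (n + k)) = inverse (2 ^ (n + k))"
      by (simp only: power_int_minus power_int_of_nat)
    then show ?thesis by (simp add: power_add shift_def field_simps)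
  qed
  have "covers (shift n) (shift n + cut n)"
    using covers_join covers_piece3 covers_piece4(2) by blast
  moreover have "1 / (2 ^ 2 * shift n) * shift n = 1/4" "1 / (2 ^ 2 * shift n) * (shift n + cut n) = cut n"
    using cut_eq[of n] shift_ge_1[of n] by (simp_all add: field_simps)
  ultimately have "covers (1/4) (cut n)"
    using covers_scale[of "shift n" "shift n + cut n" "- int (n + 2)"] unfolding p by (simp only:)
  then show "covers (cut n / 2) (cut n)" using covers_join covers_piece4(1) by blast
  have "1 / (2 ^ 1 * shift n) * (- shift n - cut n) = - 2 * cut n" "1 / (2 ^ 1 * shift n) * - shift n = -1/2"
    using cut_eq[of n] shift_ge_1[of n] by (simp_all add: field_simps)
  then have "covers (- 2 * cut n) (-1/2)"
    using covers_scale[OF covers_piece2, of "- int (n + 1)"] unfolding p by (simp only:)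
  then show "covers (- 2 * cut n) (- cut n)" using covers_join covers_piece1 by blast
qed

lemma covers_positive: "0 < a \<Longrightarrow> covers a b"
proof -
  assume a: "0 < a"
  let ?c = "cut n / 2"
  have c: "?c > 0" using cut_bounds[of n] by simp
  have oct: "covers ?c (2 * ?c)" using covers_octaves(1) by simp
  \<comment> \<open>Each step of the induction adds one scaled octave at either end.\<close>
  have grow: "covers (?c / 2 ^ k) (?c * 2 ^ Suc k)" for k
  proof (induction k)
    case 0 then show ?case using oct by simp
  next
    case (Suc k)
    have "covers (?c / 2 ^ Suc k) (?c / 2 ^ k)"
      using covers_scale[OF oct, of "- int (Suc k)"]
      by (simp add: power_int_minus field_simps del: of_nat_Suc)
    moreover have "covers (?c * 2 ^ Suc k) (?c * 2 ^ Suc (Suc k))"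
      using covers_scale[OF oct, of "int (Suc k)"] by (simp add: mult_ac del: of_nat_Suc)
    ultimately show ?case using Suc covers_join by blast
  qed
  have "\<exists>k. max (?c / a) (b / ?c) < 2 ^ k" by (rule real_arch_pow) simp
  then obtain k where k: "max (?c / a) (b / ?c) < 2 ^ k" by blast
  then have "?c / 2 ^ k \<le> a" "b \<le> ?c * 2 ^ k"
    using a c by (auto simp: field_simps)
  moreover have "?c * 2 ^ k \<le> ?c * 2 ^ Suc k" using c by simp
  ultimately have "?c / 2 ^ k \<le> a" "b \<le> ?c * 2 ^ Suc k" by linarith+
  with grow[of k] show ?thesis by (auto simp: covers_def)
qed

lemma covers_negative: "b < 0 \<Longrightarrow> covers a b"
proof -
  assume b: "b < 0"
  let ?c = "cut n"
  have c: "?c > 0" using cut_bounds[of n] by simp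
  have oct: "covers (- 2 * ?c) (- ?c)" by (rule covers_octaves(2))
  have grow: "covers (- ?c * 2 ^ Suc k) (- ?c / 2 ^ k)" for k
  proof (induction k)
    case 0 then show ?case using oct by (simp add: mult.commute)
  next
    case (Suc k)
    have "covers (- ?c / 2 ^ k) (- ?c / 2 ^ Suc k)"
      using covers_scale[OF oct, of "- int (Suc k)"]
      by (simp add: power_int_minus field_simps del: of_nat_Suc)
    moreover have "covers (- ?c * 2 ^ Suc (Suc k)) (- ?c * 2 ^ Suc k)"
      using covers_scale[OF oct, of "int (Suc k)"] by (simp add: mult_ac del: of_nat_Suc)
    ultimately show ?case using Suc covers_join by blast
  qed
  have "\<exists>k. max (?c / - b) (- a / ?c) < 2 ^ k" by (rule real_arch_pow) simp
  then obtain k where k: "max (?c / - b) (- a / ?c) < 2 ^ k" by blast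
  then have "- ?c * 2 ^ k \<le> a" "b \<le> - ?c / 2 ^ k"
    using b c by (auto simp: field_simps)
  moreover have "?c * 2 ^ k \<le> ?c * 2 ^ Suc k" using c by simp
  ultimately have "- ?c * 2 ^ Suc k \<le> a" "b \<le> - ?c / 2 ^ k" by linarith+
  with grow[of k] show ?thesis by (auto simp: covers_def)
qed

lemma freq_system_complete: "closed_span (range (freq_system n)) = L2R"
proof (rule closed_span_eq_L2R[OF range_freq_system])
  let ?H = "closed_span (range (freq_system n))"
  fix x y :: real assume "x < y"
  have Ioc: "indicator {a<..b} \<in> ?H" if "0 < a \<or> b < 0" for a b
  proof (cases "a < b")
    case True
    then show ?thesis using that covers_positive[of a b] covers_negative[of b a] coversD by blast
  next
    case False
    then have "(indicator {a<..b} :: real \<Rightarrow> complex) = 0" by (auto simp: fun_eq_iff zero_fun_apply)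
    then show ?thesis by (simp add: closed_spanI_span cfun.span_zero)
  qed
  \<comment> \<open>Dyadic scaling never reaches 0, so a shrinking gap around 0 is left out; in the
    limit a single point is missing.\<close>
  define \<epsilon> :: "nat \<Rightarrow> real" where "\<epsilon> k = 1 / Suc k" for k
  define u :: "nat \<Rightarrow> real \<Rightarrow> complex"
    where "u k = indicator {x<..min y (- \<epsilon> k)} + indicator {max x (\<epsilon> k)<..y}" for k
  have e: "\<epsilon> k > 0" for k by (simp add: \<epsilon>_def)
  have "indicator ({x<..y} - {0}) \<in> ?H"
  proof (rule closed_span_dominated[OF range_freq_system L2R_indicator_Ioc[of x y]])
    show "u k \<in> ?H" for k
      unfolding u_def using e[of k] by (intro closed_span_add range_freq_system Ioc) auto
    show "cmod (u k t) \<le> cmod (indicator {x<..y} t)" for k t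
      using e[of k] by (auto simp: u_def plus_fun_apply indicator_def)
    show "(\<lambda>k. u k t) \<longlonglongrightarrow> indicator ({x<..y} - {0}) t" for t
    proof (cases "t = 0")
      case True
      then have "u k t = 0" for k using e[of k] by (auto simp: u_def plus_fun_apply indicator_def)
      then show ?thesis using True by simp
    next
      case False
      then obtain m where m: "\<epsilon> m < \<bar>t\<bar>" unfolding \<epsilon>_def
        using reals_Archimedean[of "\<bar>t\<bar>"] by (auto simp: inverse_eq_divide)
      have "u k t = indicator ({x<..y} - {0}) t" if "k \<ge> m" for k
      proof -
        have "\<epsilon> k \<le> \<epsilon> m" using that by (simp add: \<epsilon>_def frac_le)
        then show ?thesis using m e[of k] by (auto simp: u_def plus_fun_apply indicator_def)
      qed
      then have "\<forall>\<^sub>F k in sequentially. u k t = indicator ({x<..y} - {0}) t"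
        by (auto simp: eventually_sequentially)
      then show ?thesis by (rule tendsto_eventually)
    qed
  qed auto
  moreover have "AE t in lborel. indicator ({x<..y} - {0}) t = (indicator {x<..y} t :: complex)"
    using AE_lborel_singleton[of 0] by eventually_elim (auto simp: indicator_def)
  ultimately show "indicator {x<..y} \<in> ?H"
    using closed_span_AE[OF range_freq_system] by auto
qed

end

lemma wavelet_psi: "wavelet (psi n)"
proof -
  have eq: "wavelet_system (psi n) = (\<lambda>i. fourier (freq_system n i))"
    by (rule ext) (rule wavelet_system_psi)
  have "range (wavelet_system (psi n)) = fourier ` range (freq_system n)"
    by (auto simp: eq)
  then have "closed_span (range (wavelet_system (psi n))) = L2R"
    using fourier_complete[OF _ freq_system_complete] freq_system_bounded_support by (metis image_subsetI)
  moreover have "psi n \<in> L2R"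
    using fourier_L2R[OF freq_system_bounded_support, of n "(0, 0)"]
    by (simp add: psi_def freq_system_def lift_trig)
  ultimately show ?thesis
    unfolding wavelet_def orthonormal_basis_def
    by (simp add: eq fourier_L2R freq_system_bounded_support l2_inner_fourier freq_system_orthonormal)
qed

section \<open>The core space as an orthogonal complement, and its translates\<close>

lemma closed_span_orthonormal_basis:
  assumes b: "orthonormal_basis b" and f: "f \<in> L2R" and orth: "\<And>i. i \<notin> J \<Longrightarrow> l2_inner f (b i) = 0"
  shows "f \<in> closed_span (b ` J)"
proof -
  have bL: "b i \<in> L2R" and on: "l2_inner (b i) (b j) = (if i = j then 1 else 0)" for i j
    using b by (auto simp: orthonormal_basis_def)
  show ?thesis
    unfolding closed_span_def
  proof (intro CollectI conjI allI impI f)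
    fix e :: real assume "e > 0"
    moreover have "f \<in> closed_span (range b)" using b f by (simp add: orthonormal_basis_def)
    ultimately obtain g where g: "g \<in> cfun.span (range b)" "l2_norm (f - g) < e"
      using closed_spanD by blast
    have "range b = b ` J \<union> b ` (- J)" by blast
    then obtain g1 g2 where g12: "g = g1 + g2" "g1 \<in> cfun.span (b ` J)" "g2 \<in> cfun.span (b ` (- J))"
      using g(1) by (auto simp: cfun.span_Un)
    have L: "g1 \<in> L2R" "g2 \<in> L2R"
      using g12 L2R_span[of "b ` J"] L2R_span[of "b ` (- J)"] bL by auto
    have o1: "l2_inner g1 (b i) = 0" if "i \<notin> J" for i
    proof (rule l2_inner_closed_span_zero[of "b ` J"])
      show "g1 \<in> closed_span (b ` J)" by (rule closed_spanI_span[OF g12(2) L(1)])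
    qed (use bL on that in auto)
    have "l2_inner g2 (f - g1) = 0"
    proof (rule l2_inner_closed_span_zero[of "b ` (- J)"])
      show "g2 \<in> closed_span (b ` (- J))" by (rule closed_spanI_span[OF g12(3) L(2)])
      fix h assume "h \<in> b ` (- J)"
      then obtain i where "h = b i" "i \<notin> J" by auto
      then have "l2_inner (f - g1) h = 0" using orth o1 f L bL by (simp add: l2_inner_diff_left)
      then show "l2_inner h (f - g1) = 0" by (metis l2_inner_cnj complex_cnj_zero)
    qed (use bL f L in \<open>auto intro: L2R_diff\<close>)
    then have "l2_inner (f - g1) g2 = 0" by (metis l2_inner_cnj complex_cnj_zero)
    then have "(l2_norm (f - g))\<^sup>2 = (l2_norm (f - g1))\<^sup>2 + (l2_norm g2)\<^sup>2"
      using l2_norm_diff_sq[of "f - g1" g2] f L by (simp add: L2R_diff g12(1) diff_diff_eq)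
    then have "(l2_norm (f - g1))\<^sup>2 \<le> (l2_norm (f - g))\<^sup>2" by simp
    then have "l2_norm (f - g1) \<le> l2_norm (f - g)" by (rule power2_le_imp_le) simp
    with g(2) g12(2) show "\<exists>h\<in>cfun.span (b ` J). l2_norm (f - h) < e" by (intro bexI[of _ g1]) auto
  qed
qed

text \<open>Membership becomes a test against the levels \<open>j \<ge> 0\<close>. With the adjoint
  of a translation, invariance turns into a question about translates of these basis
  elements.\<close>

lemma core_space_iff:
  assumes "wavelet \<psi>"
  shows "f \<in> core_space \<psi> \<longleftrightarrow>
    f \<in> L2R \<and> (\<forall>j l. 0 \<le> j \<longrightarrow> l2_inner f (wavelet_system \<psi> (j, l)) = 0)"
proof -
  let ?b = "wavelet_system \<psi>"
  have b: "orthonormal_basis ?b" using assms by (simp add: wavelet_def)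
  have core: "core_space \<psi> = closed_span (?b ` {(j, l). j < 0})"
    unfolding core_space_def by (rule arg_cong[where f = closed_span]) auto
  have bL: "?b i \<in> L2R" and on: "l2_inner (?b i) (?b j) = (if i = j then 1 else 0)" for i j
    using b unfolding orthonormal_basis_def by blast+
  show ?thesis
  proof (intro iffI conjI allI impI)
    assume f: "f \<in> core_space \<psi>"
    then show "f \<in> L2R" using closed_span_L2R by (auto simp: core)
    fix j l :: int assume j: "0 \<le> j"
    show "l2_inner f (?b (j, l)) = 0"
      by (rule l2_inner_closed_span_zero[of "?b ` {(j, l). j < 0}"])
        (use f core bL on j in auto)
  next
    assume f: "f \<in> L2R \<and> (\<forall>j l. 0 \<le> j \<longrightarrow> l2_inner f (?b (j, l)) = 0)"
    show "f \<in> core_space \<psi>"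
      unfolding core by (rule closed_span_orthonormal_basis[OF b]) (use f in auto)
  qed
qed

lemma l2_inner_translation: "l2_inner (translation a f) g = l2_inner f (translation (- a) g)"
  using lborel_integral_real_affine[of 1 "\<lambda>x. f (x - a) * cnj (g x)" a]
  by (simp add: l2_inner_def translation_def add.commute)

lemma L2R_translation: "f \<in> L2R \<Longrightarrow> translation a f \<in> L2R"
proof -
  assume f: "f \<in> L2R"
  have "integrable lborel (\<lambda>x. (cmod (f (- a + 1 * x)))\<^sup>2)"
    by (rule lborel_integrable_real_affine[OF L2R_sq_integrable[OF f]]) simp
  then show ?thesis using L2R_measurable[OF f] by (simp add: L2R_def translation_def)
qed

lemma core_space_psi_invariant: "invariant_under (translation_group n) (core_space (psi n))"
  unfolding invariant_under_def translation_group_def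
proof (intro ballI image_subsetI)
  fix U f assume "U \<in> {translation (real_of_int m / 2 ^ n) |m. True}" and f: "f \<in> core_space (psi n)"
  then obtain m where U: "U = translation (real_of_int m / shift n)" by (auto simp: shift_def)
  let ?a = "real_of_int m / shift n"
  have fL: "f \<in> L2R" and orth: "\<And>j l. 0 \<le> j \<Longrightarrow> l2_inner f (fourier (freq_system n (j, l))) = 0"
    using f by (auto simp: core_space_iff[OF wavelet_psi] wavelet_system_psi)
  have "l2_inner (translation ?a f) (fourier (freq_system n (j, l))) = 0" if j: "0 \<le> j" for j l
  proof -
    let ?S = "range (\<lambda>l. freq_system n (j, l))"
    \<comment> \<open>Modulation by frequency \<open>?a\<close>, pulled inside a dilation by
      \<open>2 ^ j\<close>, has frequency \<open>2 ^ j * ?a\<close>. As \<open>j \<ge> 0\<close>,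
      this times \<open>shift n\<close> is an integer, so \<open>lift_character\<close> applies and
      the translate stays in level \<open>j\<close>.\<close>
    define \<theta> where "\<theta> = 2 ^ nat j * ?a - real_of_int l"
    define q where "q = (\<lambda>x. indicator unit_interval x * character \<theta> x)"
    have qL: "q \<in> L2R"
      using L2R_character_mult[OF L2R_indicator_Ioc] by (simp add: q_def mult.commute)
    have "\<theta> * shift n = of_int (2 ^ nat j * m - l * 2 ^ n)"
      using shift_ge_1[of n] by (simp add: \<theta>_def left_diff_distrib) (simp add: shift_def)
    from lift_character[OF this] have lq: "lift n q = (\<lambda>x. character \<theta> x * psi_hat n x)"
      by (simp add: q_def lift_unit_interval)
    have "(\<lambda>x. character ?a x * freq_system n (j, l) x) = fdilation j (lift n q)"
    proof
      fix x
      let ?r = "(2::real) powi (- j) * x"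
      have "2 ^ nat j * ?r = x" using j by (simp add: power_int_minus power_int_def field_simps)
      moreover have "character ?a (2 ^ nat j * ?r) = character (2 ^ nat j * ?a) ?r"
        by (simp only: character_def mult_ac)
      ultimately have "character ?a x = character (2 ^ nat j * ?a) ?r" by (simp only:)
      then have "character ?a x * character (- real_of_int l) ?r = character \<theta> ?r"
        using character_add[of "2 ^ nat j * ?a" "- real_of_int l"] by (simp add: \<theta>_def)
      then show "character ?a x * freq_system n (j, l) x = fdilation j (lift n q) x"
        by (simp add: lq freq_system_def fdilation_def lift_trig mult_ac)
    qed
    then have tr: "translation (- ?a) (fourier (freq_system n (j, l))) = fourier (fdilation j (lift n q))"
      by (simp add: translation_fourier)
    have cs: "fourier (fdilation j (lift n q)) \<in> closed_span (fourier ` ?S)"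
      by (intro fourier_closed_span fdilation_lift_closed_span bounded_support_fdilation
          bounded_support_lift qL) (auto simp: freq_system_bounded_support)
    have "l2_inner (fourier (fdilation j (lift n q))) f = 0"
    proof (rule l2_inner_closed_span_zero[OF _ fL cs])
      show "fourier ` ?S \<subseteq> L2R" by (auto simp: fourier_L2R freq_system_bounded_support)
      fix g assume "g \<in> fourier ` ?S"
      then show "l2_inner g f = 0" using orth[OF j] by (metis (no_types, lifting) imageE l2_inner_cnj complex_cnj_zero)
    qed
    then show ?thesis unfolding l2_inner_translation tr by (metis l2_inner_cnj complex_cnj_zero)
  qed
  then show "U f \<in> core_space (psi n)"
    using fL by (auto simp: U core_space_iff[OF wavelet_psi] wavelet_system_psi L2R_translation)
qed

text \<open>On \<open>piece4\<close> the points are positive and at most 1/4 and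
  \<open>shift n\<close> is at least 1, so the phase has modulus at most \<open>pi / 4\<close> and
  the real part of the integrand stays above \<open>cos (pi / 4)\<close>.\<close>

lemma integral_character_piece4_nonzero:
  "(\<integral>x. character (- (1 / (2 * shift n))) x * indicator (piece4 n) x \<partial>lborel) \<noteq> 0"
    (is "(\<integral>x. ?f x \<partial>lborel) \<noteq> 0")
proof -
  let ?P = "piece4 n"
  have "integrable lborel (indicator ?P :: real \<Rightarrow> complex)"
    using bounded_support_integrable[OF bounded_support_indicator_Ioc] by (simp add: piece4_def)
  then have f: "integrable lborel ?f"
    using integrable_mult_character[of "indicator ?P" "- (1 / (2 * shift n))"]
    by (simp add: mult.commute)
  have i: "integrable lborel (\<lambda>x. cos (pi / 4) * indicator ?P x :: real)"
    using cut_bounds[of n] by (simp add: piece4_def integrable_indicator_iff)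
  have pos: "cos (pi / 4) > (0 :: real)" by (simp add: cos_45)
  have "0 < cos (pi / 4) * measure lborel ?P"
    using pos cut_bounds[of n] by (simp add: piece4_def)
  also have "\<dots> = (\<integral>x. cos (pi / 4) * indicator ?P x \<partial>lborel)"
    by simp
  also have "\<dots> \<le> (\<integral>x. Re (?f x) \<partial>lborel)"
  proof (rule integral_mono[OF i])
    show "integrable lborel (\<lambda>x. Re (?f x))" by (rule integrable_Re[OF f])
    fix x
    show "cos (pi / 4) * indicator ?P x \<le> Re (?f x)"
    proof (cases "x \<in> ?P")
      case True
      then have x: "0 < x" "x \<le> 1/4" using cut_bounds[of n] by (auto simp: piece4_def)
      have "x / shift n \<le> x / 1" using x shift_ge_1[of n] by (intro divide_left_mono) auto
      then have "x / shift n \<le> 1 / 4" using x by linarith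
      then have "pi * (x / shift n) \<le> pi * (1 / 4)" by (rule mult_left_mono) simp
      moreover have "0 \<le> pi * (x / shift n)" using x shift_ge_1[of n] by simp
      ultimately have "cos (pi / 4) \<le> cos (pi * (x / shift n))"
        by (intro cos_monotone_0_pi_le) auto
      moreover have "Re (?f x) = cos (pi * (x / shift n))"
        using True by (simp add: character_def)
      ultimately show ?thesis using True by simp
    qed simp
  qed
  also have "\<dots> = Re (\<integral>x. ?f x \<partial>lborel)" by (rule integral_Re[OF f])
  finally show ?thesis by auto
qed

lemma core_space_psi_not_invariant:
  "\<not> invariant_under (translation_group (n + 1)) (core_space (psi n))"
proof
  assume inv: "invariant_under (translation_group (n + 1)) (core_space (psi n))"
  let ?a = "1 / (2 * shift n)" and ?f = "fourier (freq_system n (- 1, 0))"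
  have fcore: "?f \<in> core_space (psi n)"
    unfolding core_space_iff[OF wavelet_psi] wavelet_system_psi
    by (auto simp: fourier_L2R freq_system_bounded_support l2_inner_fourier freq_system_orthonormal)
  have "translation (real_of_int 1 / 2 ^ (n + 1)) \<in> translation_group (n + 1)"
    unfolding translation_group_def by blast
  then have "translation ?a \<in> translation_group (n + 1)" by (simp add: shift_def)
  then have "translation ?a ?f \<in> core_space (psi n)"
    using inv fcore by (auto simp: invariant_under_def)
  then have "l2_inner (translation ?a ?f) (fourier (freq_system n (0, 0))) = 0"
    by (auto simp: core_space_iff[OF wavelet_psi] wavelet_system_psi)
  then have "l2_inner (\<lambda>x. character (- ?a) x * freq_system n (- 1, 0) x) (freq_system n (0, 0)) = 0"
    by (simp only: translation_fourier l2_inner_fourier freq_system_bounded_support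
        bounded_support_character_mult)
  \<comment> \<open>Unfolding the dilation by \<open>- 1\<close> produces the factor
    \<open>sqrt 2\<close> and the argument \<open>2 * x\<close>, so the inner product is the overlap
    integral with \<open>\<theta> = - ?a\<close>.\<close>
  moreover have "l2_inner (\<lambda>x. character (- ?a) x * freq_system n (- 1, 0) x) (freq_system n (0, 0))
      = sqrt 2 * (\<integral>x. character (- ?a) x * (psi_hat n x * psi_hat n (2 * x)) \<partial>lborel)"
    unfolding l2_inner_def integral_mult_right_zero[symmetric]
    by (intro Bochner_Integration.integral_cong refl)
      (simp add: freq_system_def lift_trig fdilation_def mult_ac)
  ultimately have "(\<integral>x. character (- ?a) x * (psi_hat n x * psi_hat n (2 * x)) \<partial>lborel) = 0" by simp
  moreover have "character (- ?a) (shift n) = - 1"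
    using shift_ge_1[of n] by (simp add: character_def complex_eq_iff)
  ultimately show False
    using integral_character_piece4_nonzero[of n] by (simp add: integral_character_psi_hat)
qed

theorem mainTheorem4: "\<forall>n \<in> {0, 1, 2, 3}. wavelet_class_M n \<noteq> {}"
proof
  fix n :: nat
  have "psi n \<in> wavelet_class_M n"
    by (simp add: wavelet_class_M_def wavelet_class_L_def wavelet_psi core_space_psi_invariant
        core_space_psi_not_invariant[simplified])
  then show "wavelet_class_M n \<noteq> {}" by blast
qed

end
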